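(* Let $(K,v)$ be a henselian valued field such that the residue field $Kv$ is simple and not separably closed. Then $v$ is $\emptyset$-definable.
   Context: A field $F$ is called simple if its complete first-order theory $\mathrm{Th}(F)$ in the language of rings is simple in the sense of Shelah (model theory). A valuation $v$ on $K$ is $\emptyset$-definable if there is a parameter-free first-order formula in the language of rings defining its valuation ring $\mathcal{O}_v$ in $K$. *)

theory Defs
  imports "HOL-Algebra.Algebra"
begin

section \<open>First-order logic in the language of rings\<close>

datatype ring_term =
    Var nat
  | Zero
  | One
  | Neg ring_term
  | Add ring_term ring_term
  | Mul ring_term ring_term

datatype ring_formula =
    FEq ring_term ring_term
  | FNot ring_formula
  | FAnd ring_formula ring_formula
  | FEx nat ring_formula

primrec term_vars :: "ring_term \<Rightarrow> nat set" where
  "term_vars (Var i) = {i}"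
| "term_vars Zero = {}"
| "term_vars One = {}"
| "term_vars (Neg s) = term_vars s"
| "term_vars (Add s t) = term_vars s \<union> term_vars t"
| "term_vars (Mul s t) = term_vars s \<union> term_vars t"

primrec free_vars :: "ring_formula \<Rightarrow> nat set" where
  "free_vars (FEq s t) = term_vars s \<union> term_vars t"
| "free_vars (FNot \<phi>) = free_vars \<phi>"
| "free_vars (FAnd \<phi> \<psi>) = free_vars \<phi> \<union> free_vars \<psi>"
| "free_vars (FEx i \<phi>) = free_vars \<phi> - {i}"

text \<open>
  A structure for the language of rings is a HOL-Algebra ring record, read without any axioms;
  the symbol for negation is interpreted by the derived operation \<open>a_inv\<close>. Nothing is lost by this for theories of fields,
  since the field axioms determine negation.
\<close>

definition ring_structure :: "('a, 'b) ring_scheme \<Rightarrow> bool" where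
  "ring_structure M \<longleftrightarrow>
     \<zero>\<^bsub>M\<^esub> \<in> carrier M \<and> \<one>\<^bsub>M\<^esub> \<in> carrier M \<and>
     (\<forall>x\<in>carrier M. \<ominus>\<^bsub>M\<^esub> x \<in> carrier M) \<and>
     (\<forall>x\<in>carrier M. \<forall>y\<in>carrier M. x \<oplus>\<^bsub>M\<^esub> y \<in> carrier M \<and> x \<otimes>\<^bsub>M\<^esub> y \<in> carrier M)"

primrec term_val :: "('a, 'b) ring_scheme \<Rightarrow> (nat \<Rightarrow> 'a) \<Rightarrow> ring_term \<Rightarrow> 'a" where
  "term_val M e (Var i) = e i"
| "term_val M e Zero = \<zero>\<^bsub>M\<^esub>"
| "term_val M e One = \<one>\<^bsub>M\<^esub>"
| "term_val M e (Neg s) = \<ominus>\<^bsub>M\<^esub> (term_val M e s)"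
| "term_val M e (Add s t) = term_val M e s \<oplus>\<^bsub>M\<^esub> term_val M e t"
| "term_val M e (Mul s t) = term_val M e s \<otimes>\<^bsub>M\<^esub> term_val M e t"

primrec sat :: "('a, 'b) ring_scheme \<Rightarrow> (nat \<Rightarrow> 'a) \<Rightarrow> ring_formula \<Rightarrow> bool" where
  "sat M e (FEq s t) \<longleftrightarrow> term_val M e s = term_val M e t"
| "sat M e (FNot \<phi>) \<longleftrightarrow> \<not> sat M e \<phi>"
| "sat M e (FAnd \<phi> \<psi>) \<longleftrightarrow> sat M e \<phi> \<and> sat M e \<psi>"
| "sat M e (FEx i \<phi>) \<longleftrightarrow> (\<exists>a\<in>carrier M. sat M (e(i := a)) \<phi>)"

definition tuples :: "('a, 'b) ring_scheme \<Rightarrow> nat \<Rightarrow> 'a list set" where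
  "tuples M n = {xs. length xs = n \<and> set xs \<subseteq> carrier M}"

text \<open>
  The tuple \<open>xs\<close> interprets the variables \<open>0, \<dots>, length xs - 1\<close>. It is only used for formulas
  whose free variables are among these, so that the unspecified values of \<open>(!)\<close> beyond the
  length of \<open>xs\<close> are irrelevant.
\<close>

definition sat_tuple :: "('a, 'b) ring_scheme \<Rightarrow> ring_formula \<Rightarrow> 'a list \<Rightarrow> bool" where
  "sat_tuple M \<phi> xs \<longleftrightarrow> sat M (\<lambda>i. xs ! i) \<phi>"

definition Th :: "('a, 'b) ring_scheme \<Rightarrow> ring_formula set" where
  "Th M = {\<phi>. free_vars \<phi> = {} \<and> sat_tuple M \<phi> []}"

definition is_model :: "('a, 'b) ring_scheme \<Rightarrow> ring_formula set \<Rightarrow> bool" where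
  "is_model M T \<longleftrightarrow> ring_structure M \<and> (\<forall>\<phi>\<in>T. sat_tuple M \<phi> [])"

section \<open>Simple theories\<close>

text \<open>
  The formula \<open>\<phi>(x; y)\<close>, with \<open>x\<close> the variables \<open>0, \<dots>, n - 1\<close> and \<open>y\<close> the variables
  \<open>n, \<dots>, n + m - 1\<close>, has the tree property with respect to \<open>k\<close>, witnessed in \<open>M\<close> by a tree
  \<open>c\<close> of \<open>m\<close>-tuples indexed by the finite sequences of natural numbers: the instances of \<open>\<phi>\<close>
  at the successors of each node are \<open>k\<close>-inconsistent, and those along each branch are
  consistent. Consistency is relative to the elementary diagram of \<open>M\<close>; it therefore means
  realizability in \<open>M\<close> for a finite set of formulas, and finite satisfiability in \<open>M\<close> in general
  (the initial segments of a branch are cofinal among its finite subsets).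
  The root of the tree plays no role.
\<close>

definition tree_property_in ::
  "('a, 'b) ring_scheme \<Rightarrow> ring_formula \<Rightarrow> nat \<Rightarrow> nat \<Rightarrow> nat \<Rightarrow> bool" where
  "tree_property_in M \<phi> n m k \<longleftrightarrow>
     (\<exists>c :: nat list \<Rightarrow> 'a list.
        range c \<subseteq> tuples M m \<and>
        (\<forall>\<eta>. \<forall>I. finite I \<and> card I = k \<longrightarrow>
           \<not> (\<exists>b\<in>tuples M n. \<forall>i\<in>I. sat_tuple M \<phi> (b @ c (\<eta> @ [i])))) \<and>
        (\<forall>\<sigma> :: nat \<Rightarrow> nat. \<forall>N.
           \<exists>b\<in>tuples M n. \<forall>l\<in>{1..N}. sat_tuple M \<phi> (b @ c (map \<sigma> [0..<l]))))"

text \<open>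
  A theory is simple if no formula has the tree property in a model of the theory. The language
  and the tree are countable, so by the downward Loewenheim-Skolem theorem it suffices to
  consider models whose universe is a set of natural numbers (all of them, or only finitely
  many if the model is finite).
\<close>

definition simple_theory :: "ring_formula set \<Rightarrow> bool" where
  "simple_theory T \<longleftrightarrow>
     \<not> (\<exists>M :: nat ring. is_model M T \<and>
          (\<exists>\<phi> n m k. free_vars \<phi> \<subseteq> {..<n + m} \<and> 2 \<le> k \<and> tree_property_in M \<phi> n m k))"

definition simple_field :: "('a, 'b) ring_scheme \<Rightarrow> bool" where
  "simple_field F \<longleftrightarrow> field F \<and> simple_theory (Th F)"

section \<open>Separably closed fields\<close>

text \<open>Polynomials are lists of coefficients, leading coefficient first.\<close>

definition formal_deriv :: "('a, 'b) ring_scheme \<Rightarrow> 'a list \<Rightarrow> 'a list" where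
  "formal_deriv R p =
     ring.normalize R (map (\<lambda>i. [i] \<cdot>\<^bsub>R\<^esub> ring.coeff R p i) (rev [1..<length p]))"

text \<open>Separable means coprime to the derivative, i.e. without multiple roots in an algebraic closure.\<close>

definition separable_poly :: "('a, 'b) ring_scheme \<Rightarrow> 'a list \<Rightarrow> bool" where
  "separable_poly F p \<longleftrightarrow>
     (\<forall>d\<in>carrier (poly_ring F).
        d pdivides\<^bsub>F\<^esub> p \<and> d pdivides\<^bsub>F\<^esub> formal_deriv F p \<longrightarrow> d \<in> Units (poly_ring F))"

definition separably_closed :: "('a, 'b) ring_scheme \<Rightarrow> bool" where
  "separably_closed F \<longleftrightarrow> field F \<and>
     (\<forall>p\<in>carrier (poly_ring F). 0 < degree p \<and> separable_poly F p \<longrightarrow>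
        (\<exists>a\<in>carrier F. ring.eval F p a = \<zero>\<^bsub>F\<^esub>))"

section \<open>Henselian valued fields\<close>

text \<open>
  A valuation \<open>K \<rightarrow> \<Gamma> \<union> {\<infinity>}\<close> is represented by its restriction to the nonzero elements; the value
  at zero is understood to be \<open>\<infinity>\<close>, and the value of the HOL function there is ignored.
  The value group is the image of the nonzero elements, which may be a proper subgroup
  of the ordered abelian group in which \<open>v\<close> takes its values.
\<close>

locale valued_field = field K for K :: "('a, 'b) ring_scheme" (structure) +
  fixes v :: "'a \<Rightarrow> 'g::linordered_ab_group_add"
  assumes val_mult:
      "\<lbrakk>x \<in> carrier K - {\<zero>}; y \<in> carrier K - {\<zero>}\<rbrakk> \<Longrightarrow> v (x \<otimes> y) = v x + v y"
    and val_add: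
      "\<lbrakk>x \<in> carrier K - {\<zero>}; y \<in> carrier K - {\<zero>}; x \<oplus> y \<noteq> \<zero>\<rbrakk> \<Longrightarrow>
         min (v x) (v y) \<le> v (x \<oplus> y)"

definition valuation_ring ::
  "('a, 'b) ring_scheme \<Rightarrow> ('a \<Rightarrow> 'g::linordered_ab_group_add) \<Rightarrow> 'a set" where
  "valuation_ring K v = {x \<in> carrier K. x = \<zero>\<^bsub>K\<^esub> \<or> 0 \<le> v x}"

definition valuation_ideal ::
  "('a, 'b) ring_scheme \<Rightarrow> ('a \<Rightarrow> 'g::linordered_ab_group_add) \<Rightarrow> 'a set" where
  "valuation_ideal K v = {x \<in> carrier K. x = \<zero>\<^bsub>K\<^esub> \<or> 0 < v x}"

definition residue_field ::
  "('a, 'b) ring_scheme \<Rightarrow> ('a \<Rightarrow> 'g::linordered_ab_group_add) \<Rightarrow> 'a set ring" where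
  "residue_field K v = (K\<lparr>carrier := valuation_ring K v\<rparr>) Quot (valuation_ideal K v)"

text \<open>Henselianity is the lifting of simple zeros from the residue field (Hensel's lemma).\<close>

locale henselian_valued_field = valued_field +
  assumes hensel:
    "\<lbrakk>f \<in> carrier (univ_poly K (valuation_ring K v)); a \<in> valuation_ring K v;
      eval f a \<in> valuation_ideal K v; eval (formal_deriv K f) a \<notin> valuation_ideal K v\<rbrakk> \<Longrightarrow>
     \<exists>b\<in>valuation_ring K v. eval f b = \<zero> \<and> b \<ominus> a \<in> valuation_ideal K v"

definition valuation_definable ::
  "('a, 'b) ring_scheme \<Rightarrow> ('a \<Rightarrow> 'g::linordered_ab_group_add) \<Rightarrow> bool" where
  "valuation_definable K v \<longleftrightarrow>
     (\<exists>\<phi>. free_vars \<phi> \<subseteq> {0} \<and> {x \<in> carrier K. sat_tuple K \<phi> [x]} = valuation_ring K v)"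

end

theory Submission
  imports Defs
begin

text \<open>
  Let \<open>A\<close> and \<open>N\<close> be the valuation ring and its maximal ideal, \<open>f\<close> a monic polynomial over
  \<open>A\<close> whose residue has no root, and \<open>D\<close> the set of differences of elements of
  \<open>{0} \<union> {1 / f x}\<close>. Then \<open>D \<subseteq> A\<close>, and if the linear coefficient of \<open>f\<close> is a unit, Hensel's lemma
  at \<open>0\<close> gives \<open>N \<subseteq> D\<close>. An element \<open>t\<close> of \<open>N\<close> contracts \<open>D\<close>: multiplication by \<open>t\<close> and
  \<open>x \<mapsto> t + t x\<close> map \<open>D\<close> into itself, with separated images. If a unit \<open>t\<close> did the same,
  its residue would contract the analogous subset of the residue field, and the balls
  \<open>s + t\<^sup>n D\<close> there would form a tree contradicting simplicity. So \<open>N\<close> is the set of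
  all \<open>t\<close> contracting \<open>D\<close>, which is definable from the coefficients of \<open>f\<close>.

  To remove the parameters, take the union of the sets so obtained over all \<open>f\<close> of the given
  degree for which the set is the maximal ideal \<open>N'\<close> of some valuation ring \<open>A'\<close>, over which
  \<open>f\<close> has no root modulo \<open>N'\<close>. Such an \<open>A'\<close> is comparable with \<open>A\<close>, since otherwise \<open>f\<close>
  could be changed modulo \<open>N'\<close> to be congruent to \<open>X\<^sup>d + X\<close> modulo \<open>N\<close> and then have a root. If
  \<open>N'\<close> were not contained in \<open>N\<close>, then some unit of \<open>A\<close> would contract \<open>D \<supseteq> N' \<supseteq> N\<close>,
  which is impossible as before.
\<close>

section \<open>Countable elementary substructures\<close>

instance ring_term :: countable by countable_datatype
instance ring_formula :: countable by countable_datatype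

lemma finite_term_vars: "finite (term_vars s)"
  by (induction s) auto

lemma finite_free_vars: "finite (free_vars \<phi>)"
  by (induction \<phi>) (auto simp: finite_term_vars)

lemma term_val_cong:
  "(\<And>i. i \<in> term_vars s \<Longrightarrow> e i = e' i) \<Longrightarrow> term_val M e s = term_val M e' s"
  by (induction s) auto

lemma sat_cong:
  "(\<And>i. i \<in> free_vars \<phi> \<Longrightarrow> e i = e' i) \<Longrightarrow> sat M e \<phi> = sat M e' \<phi>"
proof (induction \<phi> arbitrary: e e')
  case (FEq s t)
  have "term_val M e s = term_val M e' s" "term_val M e t = term_val M e' t"
    by (rule term_val_cong, rule FEq.prems, simp)+
  then show ?case by simp
next
  case (FAnd \<phi> \<psi>)
  have "sat M e \<phi> = sat M e' \<phi>" by (rule FAnd.IH(1), rule FAnd.prems, simp)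
  moreover have "sat M e \<psi> = sat M e' \<psi>" by (rule FAnd.IH(2), rule FAnd.prems, simp)
  ultimately show ?case by simp
next
  case (FEx i \<phi>)
  have "sat M (e(i := a)) \<phi> = sat M (e'(i := a)) \<phi>" for a
  proof (rule FEx.IH)
    fix j assume "j \<in> free_vars \<phi>"
    then show "(e(i := a)) j = (e'(i := a)) j" using FEx.prems[of j] by (cases "j = i") simp_all
  qed
  then show ?case by simp
next
  case (FNot \<phi>)
  have "sat M e \<phi> = sat M e' \<phi>" by (rule FNot.IH, rule FNot.prems, simp)
  then show ?case by simp
qed

lemma term_val_closed:
  assumes "ring_structure M" "range e \<subseteq> carrier M"
  shows "term_val M e s \<in> carrier M"
proof (induction s)
  case (Var i)
  then show ?case using assms(2) by auto
qed (use assms(1) in \<open>simp_all add: ring_structure_def\<close>)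

section \<open>Skolem closures\<close>

definition list_env :: "('a, 'b) ring_scheme \<Rightarrow> 'a list \<Rightarrow> nat \<Rightarrow> 'a" where
  "list_env M xs i = (if i < length xs then xs ! i else \<zero>\<^bsub>M\<^esub>)"

text \<open>Environments enter as finite lists, padded with zero by \<open>list_env\<close>, because
  a countable set has only countably many of these. Where no witness exists, \<open>SOME\<close> may
  choose a value outside the carrier; hence the intersection with \<open>carrier M\<close> in
  \<open>skolem_closure\<close>.\<close>

definition skolem_witness ::
  "('a, 'b) ring_scheme \<Rightarrow> ring_formula \<times> nat \<times> 'a list \<Rightarrow> 'a" where
  "skolem_witness M = (\<lambda>(\<phi>, i, xs).
     SOME a. a \<in> carrier M \<and> sat M ((list_env M xs)(i := a)) \<phi>)"

primrec skolem_closure :: "('a, 'b) ring_scheme \<Rightarrow> 'a set \<Rightarrow> nat \<Rightarrow> 'a set" where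
  "skolem_closure M P 0 = P"
| "skolem_closure M P (Suc n) = skolem_closure M P n \<union>
     (skolem_witness M ` (UNIV \<times> UNIV \<times> lists (skolem_closure M P n)) \<inter> carrier M)"

lemma countable_skolem_closure:
  "countable P \<Longrightarrow> countable (skolem_closure M P n)"
  by (induction n) (auto intro!: countable_Int1 countable_image countable_SIGMA countable_lists)

lemma skolem_closure_carrier:
  "P \<subseteq> carrier M \<Longrightarrow> skolem_closure M P n \<subseteq> carrier M"
  by (induction n) auto

lemma skolem_closure_mono: "m \<le> n \<Longrightarrow> skolem_closure M P m \<subseteq> skolem_closure M P n"
  by (induction rule: dec_induct) auto

text \<open>The union of the stages of the closure works: a formula depends on finitely many
  variables, their values all lie in one stage, and the next stage contains a witness.\<close>

lemma exists_countable_Tarski_Vaught: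
  assumes P: "countable P" "P \<subseteq> carrier M" and z: "\<zero>\<^bsub>M\<^esub> \<in> carrier M"
  obtains S where "P \<subseteq> S" "S \<subseteq> carrier M" "countable S"
    "\<And>\<phi> i e. range e \<subseteq> S \<Longrightarrow> sat M e (FEx i \<phi>) \<Longrightarrow> \<exists>a\<in>S. sat M (e(i := a)) \<phi>"
proof -
  define Q where "Q = insert \<zero>\<^bsub>M\<^esub> P"
  have Q: "countable Q" "Q \<subseteq> carrier M" using P z by (auto simp: Q_def)
  define S where "S = (\<Union>n. skolem_closure M Q n)"
  have "skolem_closure M Q 0 \<subseteq> S" unfolding S_def by blast
  then have "P \<subseteq> S" by (simp add: Q_def)
  moreover have "S \<subseteq> carrier M" using skolem_closure_carrier[OF Q(2)] by (auto simp: S_def)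
  moreover have "countable S" using countable_skolem_closure[OF Q(1)] by (auto simp: S_def)
  moreover have "\<exists>a\<in>S. sat M (e(i := a)) \<phi>" if e: "range e \<subseteq> S" and ex: "sat M e (FEx i \<phi>)" for \<phi> i e
  proof -
    obtain n where n: "\<And>j. j \<in> free_vars \<phi> \<Longrightarrow> j < n"
      using finite_nat_set_iff_bounded[THEN iffD1, OF finite_free_vars[of \<phi>]] by auto
    define xs where "xs = map e [0..<n]"
    have eq: "sat M ((list_env M xs)(i := a)) \<phi> = sat M (e(i := a)) \<phi>" for a
      by (rule sat_cong) (use n in \<open>auto simp: list_env_def xs_def\<close>)
    define a where "a = skolem_witness M (\<phi>, i, xs)"
    have "\<exists>a. a \<in> carrier M \<and> sat M ((list_env M xs)(i := a)) \<phi>" using ex eq by auto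
    then have a: "a \<in> carrier M" "sat M (e(i := a)) \<phi>"
      using someI_ex[of "\<lambda>a. a \<in> carrier M \<and> sat M ((list_env M xs)(i := a)) \<phi>"] eq
      by (auto simp: a_def skolem_witness_def)
    have "\<exists>k. \<forall>j<n. e j \<in> skolem_closure M Q k"
    proof (induction n)
      case (Suc n)
      then obtain k where k: "\<forall>j<n. e j \<in> skolem_closure M Q k" by blast
      obtain l where l: "e n \<in> skolem_closure M Q l" using e by (auto simp: S_def)
      have "\<forall>j<Suc n. e j \<in> skolem_closure M Q (max k l)"
        using k l skolem_closure_mono[of k "max k l" M Q] skolem_closure_mono[of l "max k l" M Q]
        by (auto simp: less_Suc_eq)
      then show ?case by blast
    qed auto
    then obtain k where "\<forall>j<n. e j \<in> skolem_closure M Q k" by blast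
    then have "xs \<in> lists (skolem_closure M Q k)" by (simp add: xs_def in_lists_conv_set)
    then have "a \<in> skolem_closure M Q (Suc k)" using a(1) by (auto simp: a_def)
    then have "a \<in> S" unfolding S_def by blast
    then show ?thesis using a(2) by blast
  qed
  ultimately show ?thesis by (rule that)
qed

section \<open>Elementary substructures on the natural numbers\<close>

lemma (in field) field_ring_structure: "ring_structure R"
  by (auto simp: ring_structure_def)


text \<open>Downward Loewenheim-Skolem: a countable Tarski-Vaught subset of the field is transported
  to the natural numbers by an enumeration, and \<open>g\<close> is the resulting elementary
  embedding.\<close>

lemma (in field) exists_elementary_nat_model:
  assumes P: "countable P" "P \<subseteq> carrier R"
  obtains M :: "nat ring" and g where "ring_structure M" "g ` carrier M \<subseteq> carrier R"
    "P \<subseteq> g ` carrier M"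
    "\<And>\<phi> e. range e \<subseteq> carrier M \<Longrightarrow> sat M e \<phi> = sat R (g \<circ> e) \<phi>"
proof -
  obtain S where S: "insert \<zero> P \<subseteq> S" "S \<subseteq> carrier R" "countable S"
    and TV: "\<And>\<phi> i e. range e \<subseteq> S \<Longrightarrow> sat R e (FEx i \<phi>) \<Longrightarrow> \<exists>a\<in>S. sat R (e(i := a)) \<phi>"
    using exists_countable_Tarski_Vaught[of "insert \<zero> P" R] P zero_closed
    by (metis countable_insert insert_subset)
  \<comment> \<open>The value of a term is the only witness of \<open>FEx n (FEq (Var n) s)\<close>
    for a variable \<open>n\<close> not in \<open>s\<close>. So the Tarski-Vaught property already
    makes \<open>S\<close> closed under the operations.\<close>
  have val: "term_val R e s \<in> S" if e: "range e \<subseteq> S" for e s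
  proof -
    obtain n where n: "n \<notin> term_vars s"
      using ex_new_if_finite[OF infinite_UNIV_nat finite_term_vars[of s]] by auto
    have eq: "term_val R (e(n := a)) s = term_val R e s" for a
      by (rule term_val_cong) (use n in auto)
    have "range e \<subseteq> carrier R" using e S(2) by blast
    then have "term_val R e s \<in> carrier R" by (rule term_val_closed[OF field_ring_structure])
    then have "sat R e (FEx n (FEq (Var n) s))" using eq by simp
    then obtain a where "a \<in> S" "sat R (e(n := a)) (FEq (Var n) s)" using TV[OF e] by blast
    then show ?thesis using eq by simp
  qed
  have Sadd: "a \<oplus> b \<in> S" and Smul: "a \<otimes> b \<in> S" and Sneg: "\<ominus> a \<in> S" and Sone: "\<one> \<in> S"
    if "a \<in> S" "b \<in> S" for a b
    using val[of "\<lambda>i. if i = 0 then a else b" "Add (Var 0) (Var 1)"]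
      val[of "\<lambda>i. if i = 0 then a else b" "Mul (Var 0) (Var 1)"]
      val[of "\<lambda>_. a" "Neg (Var 0)"] val[of "\<lambda>_. a" One] that by (auto split: if_splits)
  define h where "h = to_nat_on S"
  define g where "g = from_nat_into S"
  have gh: "g (h a) = a" if "a \<in> S" for a using that S(3) by (simp add: g_def h_def)
  define M :: "nat ring" where "M = \<lparr>carrier = h ` S, monoid.mult = (\<lambda>x y. h (g x \<otimes> g y)),
    one = h \<one>, ring.zero = h \<zero>, ring.add = (\<lambda>x y. h (g x \<oplus> g y))\<rparr>"
  have gM: "g x \<in> S" if "x \<in> carrier M" for x using that gh by (auto simp: M_def)
  have hg: "h (g x) = x" if "x \<in> carrier M" for x using that gh by (auto simp: M_def)
  have S0: "\<zero> \<in> S" using S(1) by simp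
  \<comment> \<open>Negation is not a component of the record but a definite description, so the
    uniqueness of additive inverses in \<open>M\<close> has to be checked.\<close>
  have neg: "\<ominus>\<^bsub>M\<^esub> x = h (\<ominus> g x)" if x: "x \<in> carrier M" for x
    unfolding a_inv_def[of M] m_inv_def
  proof (rule the_equality)
    have a: "g x \<in> S" using gM x by simp
    then have c: "g x \<in> carrier R" using S(2) by blast
    show "h (\<ominus> g x) \<in> carrier (add_monoid M) \<and> x \<otimes>\<^bsub>add_monoid M\<^esub> h (\<ominus> g x) = \<one>\<^bsub>add_monoid M\<^esub> \<and>
        h (\<ominus> g x) \<otimes>\<^bsub>add_monoid M\<^esub> x = \<one>\<^bsub>add_monoid M\<^esub>"
      using a c Sneg[OF a a] by (simp add: M_def gh r_neg l_neg)
  next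
    fix y assume y: "y \<in> carrier (add_monoid M) \<and> x \<otimes>\<^bsub>add_monoid M\<^esub> y = \<one>\<^bsub>add_monoid M\<^esub> \<and>
        y \<otimes>\<^bsub>add_monoid M\<^esub> x = \<one>\<^bsub>add_monoid M\<^esub>"
    then have yM: "y \<in> carrier M" and "h (g y \<oplus> g x) = h \<zero>" by (simp_all add: M_def)
    then have "g (h (g y \<oplus> g x)) = g (h \<zero>)" by simp
    then have "g y \<oplus> g x = \<zero>" using gh Sadd[OF gM[OF yM] gM[OF x]] S0 by simp
    then have "g y = \<ominus> g x" using gM[OF yM] gM[OF x] S(2) by (metis minus_equality subsetD)
    then show "y = h (\<ominus> g x)" using hg[OF yM] by simp
  qed
  have rs: "ring_structure M"
    using neg Sneg Sone gM S0 Sadd Smul by (simp add: ring_structure_def) (simp add: M_def)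
  have tv: "g (term_val M e s) = term_val R (g \<circ> e) s" if e: "range e \<subseteq> carrier M" for e s
  proof (induction s)
    case (Neg s)
    have c: "term_val M e s \<in> carrier M" by (rule term_val_closed[OF rs e])
    then have "g (term_val M e s) \<in> S" by (rule gM)
    then have "g (h (\<ominus> g (term_val M e s))) = \<ominus> g (term_val M e s)" using gh[OF Sneg] by blast
    then show ?case using Neg neg[OF c] by simp
  next
    case (Add s t)
    have "term_val M e s \<in> carrier M" "term_val M e t \<in> carrier M" by (rule term_val_closed[OF rs e])+
    then have "g (h (g (term_val M e s) \<oplus> g (term_val M e t))) = g (term_val M e s) \<oplus> g (term_val M e t)"
      using gM Sadd gh by simp
    then show ?case using Add by (simp add: M_def)
  next
    case (Mul s t)
    have "term_val M e s \<in> carrier M" "term_val M e t \<in> carrier M" by (rule term_val_closed[OF rs e])+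
    then have "g (h (g (term_val M e s) \<otimes> g (term_val M e t))) = g (term_val M e s) \<otimes> g (term_val M e t)"
      using gM Smul gh by simp
    then show ?case using Mul by (simp add: M_def)
  next
    case One
    then show ?case using gh[OF Sone[OF S0 S0]] by (simp add: M_def)
  next
    case Zero
    then show ?case using gh[OF S0] by (simp add: M_def)
  qed simp
  have sat: "sat M e \<phi> = sat R (g \<circ> e) \<phi>" if "range e \<subseteq> carrier M" for e \<phi>
    using that
  proof (induction \<phi> arbitrary: e)
    case (FEq s t)
    have "term_val M e s = term_val M e t \<longleftrightarrow> g (term_val M e s) = g (term_val M e t)"
      using term_val_closed[OF rs FEq] hg by metis
    then show ?case using tv[OF FEq] by (simp only: sat.simps)
  next
    case (FEx i \<phi>)
    have upd: "g \<circ> e(i := a) = (g \<circ> e)(i := g a)" for a by (auto simp: fun_eq_iff)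
    have ge: "range (g \<circ> e) \<subseteq> S" using FEx.prems gM by auto
    have IH: "sat M (e(i := a)) \<phi> = sat R ((g \<circ> e)(i := g a)) \<phi>" if "a \<in> carrier M" for a
    proof -
      have "range (e(i := a)) \<subseteq> carrier M" using FEx.prems that by auto
      from FEx.IH[OF this] show ?thesis by (simp only: upd)
    qed
    show ?case
    proof
      assume "sat M e (FEx i \<phi>)"
      then obtain a where "a \<in> carrier M" "sat M (e(i := a)) \<phi>" by auto
      then show "sat R (g \<circ> e) (FEx i \<phi>)" using IH gM S(2) by auto
    next
      assume "sat R (g \<circ> e) (FEx i \<phi>)"
      then obtain a where "a \<in> S" "sat R ((g \<circ> e)(i := a)) \<phi>" using TV[OF ge] by blast
      then have "h a \<in> carrier M" "sat M (e(i := h a)) \<phi>" using IH[of "h a"] gh by (auto simp: M_def)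
      then show "sat M e (FEx i \<phi>)" by auto
    qed
  next
    case (FNot \<phi>)
    show ?case using FNot.IH[OF FNot.prems] by simp
  next
    case (FAnd \<phi> \<psi>)
    show ?case using FAnd.IH(1)[OF FAnd.prems] FAnd.IH(2)[OF FAnd.prems] by simp
  qed
  have "g ` carrier M = S" using gh by (force simp: M_def)
  then have "g ` carrier M \<subseteq> carrier R" "P \<subseteq> g ` carrier M" using S by simp_all
  then show ?thesis using that[OF rs _ _ sat] by simp
qed

text \<open>\<open>simple_theory\<close> speaks only about structures on the natural numbers. A tree
  in the field is moved to an elementary substructure containing its nodes and the realizations of
  its finite paths; inconsistency is inherited because every tuple of \<open>M\<close> is mapped
  into the field.\<close>

lemma (in field) simple_not_tree_property:
  assumes simple: "simple_theory (Th R)" and fv: "free_vars \<phi> \<subseteq> {..<n + m}" and k: "2 \<le> k"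
  shows "\<not> tree_property_in R \<phi> n m k"
proof
  assume "tree_property_in R \<phi> n m k"
  then obtain c :: "nat list \<Rightarrow> 'a list" where c: "range c \<subseteq> tuples R m"
    and inc: "\<And>\<eta> I. finite I \<Longrightarrow> card I = k \<Longrightarrow>
        \<not> (\<exists>b\<in>tuples R n. \<forall>i\<in>I. sat_tuple R \<phi> (b @ c (\<eta> @ [i])))"
    and con: "\<And>\<sigma> N. \<exists>b\<in>tuples R n. \<forall>l\<in>{1..N}. sat_tuple R \<phi> (b @ c (map \<sigma> [0..<l]))"
    unfolding tree_property_in_def by metis
  \<comment> \<open>Realizations are indexed by finite sequences instead of branches: there are only
    countably many of these, so all realizations fit into the countable set
    \<open>P\<close>.\<close>
  have "\<exists>b. b \<in> tuples R n \<and> (\<forall>l\<in>{1..length \<theta>}. sat_tuple R \<phi> (b @ c (take l \<theta>)))" for \<theta>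
  proof -
    obtain b where b: "b \<in> tuples R n"
      "\<forall>l\<in>{1..length \<theta>}. sat_tuple R \<phi> (b @ c (map (\<lambda>i. \<theta> ! i) [0..<l]))"
      using con[of "length \<theta>" "\<lambda>i. \<theta> ! i"] by blast
    have "map (\<lambda>i. \<theta> ! i) [0..<l] = take l \<theta>" if "l \<in> {1..length \<theta>}" for l
      using that by (intro nth_equalityI) auto
    then show ?thesis using b by auto
  qed
  then obtain b where b: "\<And>\<theta>. b \<theta> \<in> tuples R n"
    "\<And>\<theta> l. l \<in> {1..length \<theta>} \<Longrightarrow> sat_tuple R \<phi> (b \<theta> @ c (take l \<theta>))"
    by metis
  define P where "P = (\<Union>\<eta>. set (c \<eta>)) \<union> (\<Union>\<theta>. set (b \<theta>))"
  have "countable P" 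
    unfolding P_def by (intro countable_Un countable_UN countableI_type countable_finite finite_set)
  moreover have "P \<subseteq> carrier R"
  proof -
    have "set (c \<eta>) \<subseteq> carrier R" "set (b \<eta>) \<subseteq> carrier R" for \<eta>
      using c b(1)[of \<eta>] unfolding tuples_def by blast+
    then show ?thesis unfolding P_def by blast
  qed
  ultimately obtain M :: "nat ring" and g where rs: "ring_structure M"
    and gM: "g ` carrier M \<subseteq> carrier R" and gP: "P \<subseteq> g ` carrier M"
    and sat: "\<And>\<phi> e. range e \<subseteq> carrier M \<Longrightarrow> sat M e \<phi> = sat R (g \<circ> e) \<phi>"
    by (rule exists_elementary_nat_model) (rule that, assumption+)
  have zM: "\<zero>\<^bsub>M\<^esub> \<in> carrier M" using rs by (simp add: ring_structure_def)
  have st: "sat_tuple M \<psi> xs = sat_tuple R \<psi> (map g xs)"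
    if "set xs \<subseteq> carrier M" "free_vars \<psi> \<subseteq> {..<length xs}" for \<psi> xs
  proof -
    have "sat_tuple M \<psi> xs = sat M (list_env M xs) \<psi>"
      unfolding sat_tuple_def by (rule sat_cong) (use that in \<open>auto simp: list_env_def\<close>)
    also have "\<dots> = sat R (g \<circ> list_env M xs) \<psi>"
      by (rule sat) (use that zM in \<open>auto simp: list_env_def\<close>)
    also have "\<dots> = sat_tuple R \<psi> (map g xs)"
      unfolding sat_tuple_def by (rule sat_cong) (use that in \<open>auto simp: list_env_def\<close>)
    finally show ?thesis .
  qed
  define r where "r a = (SOME x. x \<in> carrier M \<and> g x = a)" for a
  have r: "r a \<in> carrier M" "g (r a) = a" if "a \<in> P" for a
  proof -
    have "\<exists>x. x \<in> carrier M \<and> g x = a" using gP that by auto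
    from someI_ex[OF this] show "r a \<in> carrier M" "g (r a) = a" by (simp_all add: r_def)
  qed
  have mc: "map (g \<circ> r) (c \<eta>) = c \<eta>" "set (map r (c \<eta>)) \<subseteq> carrier M" "length (c \<eta>) = m" for \<eta>
  proof -
    have "a \<in> P" if "a \<in> set (c \<eta>)" for a using that by (auto simp: P_def)
    then show "map (g \<circ> r) (c \<eta>) = c \<eta>" "set (map r (c \<eta>)) \<subseteq> carrier M"
      using r by (auto intro!: map_idI)
    show "length (c \<eta>) = m" using c by (auto simp: tuples_def image_subset_iff)
  qed
  have mb: "map (g \<circ> r) (b \<eta>) = b \<eta>" "set (map r (b \<eta>)) \<subseteq> carrier M" "length (b \<eta>) = n" for \<eta>
  proof -
    have "a \<in> P" if "a \<in> set (b \<eta>)" for a using that by (auto simp: P_def)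
    then show "map (g \<circ> r) (b \<eta>) = b \<eta>" "set (map r (b \<eta>)) \<subseteq> carrier M"
      using r by (auto intro!: map_idI)
    show "length (b \<eta>) = n" using b(1)[of \<eta>] by (simp add: tuples_def)
  qed
  have "is_model M (Th R)"
    unfolding is_model_def using rs st[of "[]"] by (auto simp: Th_def)
  moreover have "tree_property_in M \<phi> n m k"
    unfolding tree_property_in_def
  proof (intro exI[of _ "\<lambda>\<eta>. map r (c \<eta>)"] conjI allI impI)
    show "range (\<lambda>\<eta>. map r (c \<eta>)) \<subseteq> tuples M m" 
      using mc(2,3) unfolding tuples_def by fastforce
  next
    fix \<eta> :: "nat list" and I :: "nat set"
    assume I: "finite I \<and> card I = k"
    show "\<not> (\<exists>b\<in>tuples M n. \<forall>i\<in>I. sat_tuple M \<phi> (b @ map r (c (\<eta> @ [i]))))"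
    proof
      assume "\<exists>b\<in>tuples M n. \<forall>i\<in>I. sat_tuple M \<phi> (b @ map r (c (\<eta> @ [i])))"
      then obtain d where d: "d \<in> tuples M n" "\<forall>i\<in>I. sat_tuple M \<phi> (d @ map r (c (\<eta> @ [i])))"
        by blast
      have "sat_tuple M \<phi> (d @ map r (c (\<eta> @ [i]))) = sat_tuple R \<phi> (map g d @ c (\<eta> @ [i]))" for i
        using st[of "d @ map r (c (\<eta> @ [i]))" \<phi>] mc[of "\<eta> @ [i]"] d(1) fv by (simp add: tuples_def)
      moreover have "map g d \<in> tuples R n" using d(1) gM by (auto simp: tuples_def)
      ultimately show False using inc[of I \<eta>] I d(2) by blast
    qed
  next
    fix \<sigma> :: "nat \<Rightarrow> nat" and N :: nat
    define \<theta> where "\<theta> = map \<sigma> [0..<N]"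
    have "sat_tuple M \<phi> (map r (b \<theta>) @ map r (c (map \<sigma> [0..<l])))" if l: "l \<in> {1..N}" for l
    proof -
      have "sat_tuple R \<phi> (b \<theta> @ c (map \<sigma> [0..<l]))"
        using b(2)[of l \<theta>] l by (simp add: \<theta>_def take_map)
      then show ?thesis
        using st[of "map r (b \<theta>) @ map r (c (map \<sigma> [0..<l]))" \<phi>] mb[of \<theta>] mc[of "map \<sigma> [0..<l]"] fv
        by simp
    qed
    moreover have "map r (b \<theta>) \<in> tuples M n" using mb by (simp add: tuples_def)
    ultimately show "\<exists>b\<in>tuples M n. \<forall>l\<in>{1..N}. sat_tuple M \<phi> (b @ map r (c (map \<sigma> [0..<l])))"
      by blast
  qed
  ultimately show False using simple fv k unfolding simple_theory_def by blast
qed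

section \<open>Valuation subrings\<close>

lemma (in field) nonzero_inv:
  assumes "x \<in> carrier R" "x \<noteq> \<zero>"
  shows "inv x \<in> carrier R" "inv x \<noteq> \<zero>" "x \<otimes> inv x = \<one>" "inv x \<otimes> x = \<one>" "inv (inv x) = x"
proof -
  have u: "x \<in> Units R" using assms field_Units by blast
  show "inv x \<in> carrier R" "x \<otimes> inv x = \<one>" "inv x \<otimes> x = \<one>" "inv (inv x) = x"
    using u Units_inv_closed Units_r_inv Units_l_inv Units_inv_inv by auto
  then show "inv x \<noteq> \<zero>" using assms(1) one_not_zero by auto
qed

lemma (in field) inv_eqI:
  assumes "x \<in> carrier R" "y \<in> carrier R" "x \<otimes> y = \<one>"
  shows "x \<noteq> \<zero>" "y \<noteq> \<zero>" "inv x = y" "inv y = x"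
  using assms comm_inv_char[of x y] comm_inv_char[of y x] m_comm[of x y] one_not_zero
  by auto

locale valuation_subring = field R for R (structure) +
  fixes A :: "'a set"
  assumes A_sub: "A \<subseteq> carrier R"
    and one_A: "\<one> \<in> A"
    and add_A: "\<lbrakk>a \<in> A; b \<in> A\<rbrakk> \<Longrightarrow> a \<oplus> b \<in> A"
    and mult_A: "\<lbrakk>a \<in> A; b \<in> A\<rbrakk> \<Longrightarrow> a \<otimes> b \<in> A"
    and inv_A: "\<lbrakk>x \<in> carrier R; x \<noteq> \<zero>; x \<notin> A\<rbrakk> \<Longrightarrow> inv x \<in> A"
begin

definition N :: "'a set" where
  "N = {x \<in> carrier R. x = \<zero> \<or> inv x \<notin> A}"

lemma A_carrier: "a \<in> A \<Longrightarrow> a \<in> carrier R"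
  using A_sub by blast

lemma N_carrier: "a \<in> N \<Longrightarrow> a \<in> carrier R"
  by (simp add: N_def)

text \<open>The element -1 is its own inverse, so \<open>inv_A\<close> puts it into
  \<open>A\<close>.\<close>

lemma neg_A: assumes "a \<in> A" shows "\<ominus> a \<in> A"
proof -
  have "\<ominus> \<one> \<in> A" using inv_A[of "\<ominus> \<one>"] inv_neg_one one_not_zero by fastforce
  then have "\<ominus> \<one> \<otimes> a \<in> A" using assms mult_A by blast
  then show ?thesis using A_carrier[OF assms] by (simp add: l_minus)
qed

lemma minus_A: "\<lbrakk>a \<in> A; b \<in> A\<rbrakk> \<Longrightarrow> a \<ominus> b \<in> A"
  by (simp add: a_minus_def add_A neg_A)

lemma zero_A: "\<zero> \<in> A"
  using minus_A[OF one_A one_A] by (simp add: a_minus_def r_neg)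

lemma N_A: "a \<in> N \<Longrightarrow> a \<in> A"
  using inv_A[of a] zero_A by (auto simp: N_def)

lemma zero_N: "\<zero> \<in> N"
  by (simp add: N_def)

lemma one_not_N: "\<one> \<notin> N"
  by (simp add: N_def one_A)

lemma inv_unit_A: "\<lbrakk>a \<in> carrier R; a \<notin> N\<rbrakk> \<Longrightarrow> a \<noteq> \<zero> \<and> inv a \<in> A"
  by (auto simp: N_def)

lemma inv_notin_A: "\<lbrakk>x \<in> carrier R; x \<notin> A\<rbrakk> \<Longrightarrow> x \<noteq> \<zero> \<and> inv x \<in> N"
  using nonzero_inv(1,5)[of x] zero_A by (cases "x = \<zero>") (auto simp: N_def)

lemma mult_N:
  assumes a: "a \<in> A" and x: "x \<in> N"
  shows "a \<otimes> x \<in> N"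
proof (cases "a \<otimes> x = \<zero>")
  case False
  have c: "a \<in> carrier R" "x \<in> carrier R" using a x A_carrier N_carrier by auto
  have nz: "a \<noteq> \<zero>" "x \<noteq> \<zero>" using False c by auto
  have "a \<otimes> inv (a \<otimes> x) = inv x"
  proof -
    have "x \<otimes> (a \<otimes> inv (a \<otimes> x)) = (a \<otimes> x) \<otimes> inv (a \<otimes> x)"
      using c nonzero_inv(1)[OF _ False] by (simp add: m_assoc[symmetric] m_comm)
    also have "\<dots> = \<one>" using c nonzero_inv(3)[OF _ False] by simp
    finally show ?thesis
      using inv_eqI(3)[of x "a \<otimes> inv (a \<otimes> x)"] c nonzero_inv(1)[OF _ False] by simp
  qed
  then have "inv (a \<otimes> x) \<notin> A" using mult_A[OF a, of "inv (a \<otimes> x)"] x nz by (auto simp: N_def)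
  then show ?thesis using c by (simp add: N_def)
qed (simp add: zero_N)

lemma mult_N': "\<lbrakk>x \<in> N; a \<in> A\<rbrakk> \<Longrightarrow> x \<otimes> a \<in> N"
  using mult_N[of a x] m_comm[of x a] A_carrier N_carrier by simp

text \<open>One of the quotients x / y and y / x lies in \<open>A\<close>; in the first case x + y =
  (x / y + 1) y is a multiple of y by an element of \<open>A\<close>.\<close>

lemma add_N:
  assumes x: "x \<in> N" and y: "y \<in> N"
  shows "x \<oplus> y \<in> N"
proof -
  have *: "x \<oplus> y \<in> N" if x: "x \<in> N" and y: "y \<in> N" and nz: "y \<noteq> \<zero>" and q: "x \<otimes> inv y \<in> A" for x y
  proof -
    have c: "x \<in> carrier R" "y \<in> carrier R" using x y N_carrier by auto
    have "(x \<otimes> inv y \<oplus> \<one>) \<otimes> y = x \<oplus> y"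
      using c nonzero_inv[OF c(2) nz] by (simp add: l_distr m_assoc)
    then show ?thesis using mult_N[OF add_A[OF q one_A] y] by simp
  qed
  have c: "x \<in> carrier R" "y \<in> carrier R" using x y N_carrier by auto
  consider "x = \<zero>" | "y = \<zero>" | "x \<noteq> \<zero>" "y \<noteq> \<zero>" by blast
  then show ?thesis
  proof cases
    case 3
    have i: "inv y \<in> carrier R" "inv x \<in> carrier R" using 3 c nonzero_inv by auto
    show ?thesis
    proof (cases "x \<otimes> inv y \<in> A")
      case False
      have "(x \<otimes> inv y) \<otimes> (y \<otimes> inv x) = (x \<otimes> inv x) \<otimes> (y \<otimes> inv y)"
        using c i by (simp add: m_ac)
      then have "inv (x \<otimes> inv y) = y \<otimes> inv x" using c i 3 nonzero_inv by (intro inv_eqI(3)) auto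
      moreover have "x \<otimes> inv y \<noteq> \<zero>" using False zero_A by auto
      ultimately have "y \<otimes> inv x \<in> A" using inv_A[OF _ _ False] c i by auto
      then show ?thesis using *[OF y x 3(1)] c by (simp add: a_comm)
    qed (use * x y 3 in auto)
  qed (use x y c in auto)
qed

lemma neg_N: "x \<in> N \<Longrightarrow> \<ominus> x \<in> N"
  using mult_N[OF neg_A[OF one_A], of x] N_carrier[of x] by (simp add: l_minus)

lemma minus_N: "\<lbrakk>x \<in> N; y \<in> N\<rbrakk> \<Longrightarrow> x \<ominus> y \<in> N"
  by (simp add: a_minus_def add_N neg_N)

lemma add_notin_A:
  assumes "x \<in> carrier R" "x \<notin> A" "y \<in> A"
  shows "x \<oplus> y \<notin> A" "y \<oplus> x \<notin> A"
proof -
  have "(x \<oplus> y) \<ominus> y = x" using assms A_carrier[of y] by (simp add: a_minus_def a_assoc r_neg)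
  then show "x \<oplus> y \<notin> A" using minus_A[of "x \<oplus> y" y] assms by auto
  then show "y \<oplus> x \<notin> A" using assms A_carrier[of y] by (simp add: a_comm)
qed

lemma add_notin_N:
  assumes "x \<in> carrier R" "x \<notin> N" "y \<in> N"
  shows "x \<oplus> y \<notin> N"
proof -
  have "(x \<oplus> y) \<ominus> y = x" using assms N_carrier[of y] by (simp add: a_minus_def a_assoc r_neg)
  then show "x \<oplus> y \<notin> N" using minus_N[of "x \<oplus> y" y] assms by auto
qed

lemma mult_notin_A:
  assumes x: "x \<in> carrier R" "x \<notin> A" and y: "y \<in> carrier R" "y \<notin> N"
  shows "x \<otimes> y \<notin> A"
proof
  assume "x \<otimes> y \<in> A"
  then have "(x \<otimes> y) \<otimes> inv y \<in> A" using inv_unit_A[OF y] mult_A by blast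
  moreover have "(x \<otimes> y) \<otimes> inv y = x"
    using x y inv_unit_A[OF y] nonzero_inv[of y] by (simp add: m_assoc)
  ultimately show False using x by simp
qed

end

section \<open>Monic polynomials\<close>

text \<open>The list contains the coefficients in increasing degree, without the leading one.\<close>

primrec monic_val :: "('a, 'b) ring_scheme \<Rightarrow> 'a list \<Rightarrow> 'a \<Rightarrow> 'a" where
  "monic_val R [] x = \<one>\<^bsub>R\<^esub>"
| "monic_val R (c # cs) x = c \<oplus>\<^bsub>R\<^esub> x \<otimes>\<^bsub>R\<^esub> monic_val R cs x"

lemma (in ring) monic_val_closed:
  "\<lbrakk>set cs \<subseteq> carrier R; x \<in> carrier R\<rbrakk> \<Longrightarrow> monic_val R cs x \<in> carrier R"
  by (induction cs) auto

context valuation_subring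
begin

lemma monic_val_A: "\<lbrakk>set cs \<subseteq> A; x \<in> A\<rbrakk> \<Longrightarrow> monic_val R cs x \<in> A"
  by (induction cs) (auto simp: one_A add_A mult_A)

text \<open>In Horner form, the inner value is 1 or, by induction, outside \<open>A\<close>. In
  either case it is not in \<open>N\<close>, so its product with x stays outside \<open>A\<close>,
  and adding a coefficient does not change that.\<close>

lemma monic_val_notin_A:
  assumes x: "x \<in> carrier R" "x \<notin> A"
  shows "\<lbrakk>set cs \<subseteq> A; cs \<noteq> []\<rbrakk> \<Longrightarrow> monic_val R cs x \<notin> A"
proof (induction cs)
  case (Cons c cs)
  have "monic_val R cs x \<notin> N"
  proof (cases "cs = []")
    case False
    then show ?thesis using Cons N_A by auto
  qed (simp add: one_not_N)
  moreover have c: "monic_val R cs x \<in> carrier R"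
    using monic_val_closed[OF _ x(1)] Cons.prems A_sub by auto
  ultimately have "x \<otimes> monic_val R cs x \<notin> A" using mult_notin_A[OF x] by blast
  then show ?case using add_notin_A(2)[of "x \<otimes> monic_val R cs x" c] x c Cons.prems by simp
qed simp

lemma monic_val_cong:
  assumes x: "x \<in> A"
  shows "\<lbrakk>set cs \<subseteq> A; list_all2 (\<lambda>b c. b \<in> A \<and> b \<ominus> c \<in> N) bs cs\<rbrakk> \<Longrightarrow>
    monic_val R bs x \<ominus> monic_val R cs x \<in> N"
proof (induction cs arbitrary: bs)
  case (Cons c cs)
  then obtain b bs' where bs: "bs = b # bs'" "b \<in> A" "b \<ominus> c \<in> N"
      "list_all2 (\<lambda>b c. b \<in> A \<and> b \<ominus> c \<in> N) bs' cs"
    by (cases bs) auto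
  have "set bs' \<subseteq> A" using bs(4) by (auto simp: list_all2_conv_all_nth in_set_conv_nth)
  then have cl: "monic_val R bs' x \<in> carrier R" "monic_val R cs x \<in> carrier R"
      "b \<in> carrier R" "c \<in> carrier R" "x \<in> carrier R"
    using A_carrier monic_val_A x Cons.prems bs by auto
  have "(b \<ominus> c) \<oplus> x \<otimes> (monic_val R bs' x \<ominus> monic_val R cs x) \<in> N"
    using Cons.IH[of bs'] Cons.prems bs x by (intro add_N mult_N) auto
  also have "(b \<ominus> c) \<oplus> x \<otimes> (monic_val R bs' x \<ominus> monic_val R cs x) =
      monic_val R bs x \<ominus> monic_val R (c # cs) x"
    using cl unfolding bs(1) by simp algebra
  finally show ?case .
qed (simp add: a_minus_def r_neg zero_N)

end

section \<open>The sets defined by a polynomial\<close>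

text \<open>
  The equation \<open>u \<otimes> (u \<otimes> f x) = u\<close> says that \<open>u\<close> is \<open>0\<close> or the inverse of \<open>f x\<close>. Including
  \<open>0\<close> makes these sets compatible with residue maps, as \<open>1 / f x\<close> has residue \<open>0\<close> for \<open>x\<close>
  outside the valuation ring.
\<close>

definition recip_vals :: "('a, 'b) ring_scheme \<Rightarrow> 'a list \<Rightarrow> 'a set" where
  "recip_vals R cs = {u \<in> carrier R. \<exists>x\<in>carrier R. u \<otimes>\<^bsub>R\<^esub> (u \<otimes>\<^bsub>R\<^esub> monic_val R cs x) = u}"

text \<open>The difference is spelled with \<open>\<oplus>\<close> and \<open>\<ominus>\<close> like
  the terms of the language, and confined to the carrier, so that the formula for this set is
  correct in any structure.\<close>

definition recip_diffs :: "('a, 'b) ring_scheme \<Rightarrow> 'a list \<Rightarrow> 'a set" where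
  "recip_diffs R cs = {z \<in> carrier R. \<exists>u\<in>recip_vals R cs. \<exists>w\<in>recip_vals R cs. z = u \<oplus>\<^bsub>R\<^esub> \<ominus>\<^bsub>R\<^esub> w}"

definition contracts :: "('a, 'b) ring_scheme \<Rightarrow> 'a set \<Rightarrow> 'a \<Rightarrow> bool" where
  "contracts R D t \<longleftrightarrow> t \<noteq> \<zero>\<^bsub>R\<^esub> \<and>
     (\<forall>x\<in>D. t \<otimes>\<^bsub>R\<^esub> x \<in> D \<and> t \<oplus>\<^bsub>R\<^esub> t \<otimes>\<^bsub>R\<^esub> x \<in> D)"

text \<open>
  The third element \<open>y\<close> makes \<open>separates\<close> descend to the residue field if \<open>D\<close> contains the maximal
  ideal, even though \<open>D\<close> need not be a union of its cosets.
\<close>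

definition separates :: "('a, 'b) ring_scheme \<Rightarrow> 'a set \<Rightarrow> 'a \<Rightarrow> bool" where
  "separates R D t \<longleftrightarrow> (\<forall>x\<in>D. \<forall>y\<in>D. \<forall>z\<in>D.
     \<one>\<^bsub>R\<^esub> \<oplus>\<^bsub>R\<^esub> (t \<otimes>\<^bsub>R\<^esub> x \<oplus>\<^bsub>R\<^esub> t \<otimes>\<^bsub>R\<^esub> y) \<noteq> t \<otimes>\<^bsub>R\<^esub> z)"

text \<open>Disjointness of the balls 1 + t D and t D. This much of \<open>separates\<close> passes
  to the residue field, and it suffices for the tree.\<close>

definition weakly_separates :: "('a, 'b) ring_scheme \<Rightarrow> 'a set \<Rightarrow> 'a \<Rightarrow> bool" where
  "weakly_separates R D t \<longleftrightarrow> (\<forall>x\<in>D. \<forall>z\<in>D.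
     \<one>\<^bsub>R\<^esub> \<oplus>\<^bsub>R\<^esub> t \<otimes>\<^bsub>R\<^esub> x \<noteq> t \<otimes>\<^bsub>R\<^esub> z)"

definition poly_ideal :: "('a, 'b) ring_scheme \<Rightarrow> 'a list \<Rightarrow> 'a set" where
  "poly_ideal R cs = {t \<in> carrier R. t = \<zero>\<^bsub>R\<^esub> \<or>
     contracts R (recip_diffs R cs) t \<and> separates R (recip_diffs R cs) t}"

definition poly_ring_of :: "('a, 'b) ring_scheme \<Rightarrow> 'a list \<Rightarrow> 'a set" where
  "poly_ring_of R cs = {x \<in> carrier R. \<forall>y\<in>poly_ideal R cs. x \<otimes>\<^bsub>R\<^esub> y \<noteq> \<one>\<^bsub>R\<^esub>}"

text \<open>A first-order way to say that \<open>poly_ring_of R cs\<close> is a valuation ring over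
  which the polynomial is defined and has no zero modulo the maximal ideal.\<close>

definition admissible :: "('a, 'b) ring_scheme \<Rightarrow> 'a list \<Rightarrow> bool" where
  "admissible R cs \<longleftrightarrow> set cs \<subseteq> poly_ring_of R cs \<and>
     (\<forall>x\<in>poly_ring_of R cs. \<forall>y\<in>poly_ring_of R cs.
        x \<oplus>\<^bsub>R\<^esub> y \<in> poly_ring_of R cs \<and> x \<otimes>\<^bsub>R\<^esub> y \<in> poly_ring_of R cs) \<and>
     (\<forall>x\<in>poly_ring_of R cs. monic_val R cs x \<notin> poly_ideal R cs)"

context field
begin

lemma recip_vals_iff:
  assumes "set cs \<subseteq> carrier R"
  shows "u \<in> recip_vals R cs \<longleftrightarrow>
    u = \<zero> \<or> u \<in> carrier R \<and> (\<exists>x\<in>carrier R. u \<otimes> monic_val R cs x = \<one>)"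
proof -
  have "u \<otimes> (u \<otimes> monic_val R cs x) = u \<longleftrightarrow> u = \<zero> \<or> u \<otimes> monic_val R cs x = \<one>"
    if "u \<in> carrier R" "x \<in> carrier R" for u x
    using that monic_val_closed[OF assms] m_lcancel[of u "u \<otimes> monic_val R cs x" \<one>]
    by (cases "u = \<zero>") auto
  then show ?thesis by (auto simp: recip_vals_def)
qed

lemma zero_recip_vals: "set cs \<subseteq> carrier R \<Longrightarrow> \<zero> \<in> recip_vals R cs"
  by (simp add: recip_vals_iff)

lemma recip_vals_carrier: "recip_vals R cs \<subseteq> carrier R"
  by (auto simp: recip_vals_def)

lemma recip_diffs_carrier: "recip_diffs R cs \<subseteq> carrier R"
  by (auto simp: recip_diffs_def)

lemma recip_diffs_image:
  "recip_diffs R cs = (\<lambda>(u, w). u \<oplus> \<ominus> w) ` (recip_vals R cs \<times> recip_vals R cs)"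
proof -
  have "u \<oplus> \<ominus> w \<in> carrier R" if "u \<in> recip_vals R cs" "w \<in> recip_vals R cs" for u w
    using that recip_vals_carrier[of cs] by auto
  then show ?thesis by (auto simp: recip_diffs_def)
qed

lemma minus_recip_diffs:
  "\<lbrakk>u \<in> recip_vals R cs; w \<in> recip_vals R cs\<rbrakk> \<Longrightarrow> u \<ominus> w \<in> recip_diffs R cs"
  using recip_vals_carrier unfolding recip_diffs_def a_minus_def by blast

lemma zero_recip_diffs: "set cs \<subseteq> carrier R \<Longrightarrow> \<zero> \<in> recip_diffs R cs"
  using minus_recip_diffs[OF zero_recip_vals zero_recip_vals, of cs] by (simp add: a_minus_def)

text \<open>A nonzero t in the ideal is t + t 0, the image of 0 under the second map in
  \<open>contracts\<close>.\<close>

lemma poly_ideal_subset_recip_diffs: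
  assumes cs: "set cs \<subseteq> carrier R"
  shows "poly_ideal R cs \<subseteq> recip_diffs R cs"
proof
  fix t assume t: "t \<in> poly_ideal R cs"
  show "t \<in> recip_diffs R cs"
  proof (cases "t = \<zero>")
    case False
    then have "t \<oplus> t \<otimes> \<zero> \<in> recip_diffs R cs"
      using t zero_recip_diffs[OF cs] by (auto simp: poly_ideal_def contracts_def)
    then show ?thesis using t by (simp add: poly_ideal_def)
  qed (simp add: zero_recip_diffs[OF cs])
qed

text \<open>The case x = y = 0 of \<open>separates\<close>. Since \<open>poly_ideal\<close> is
  contained in \<open>recip_diffs\<close>, no two of its elements are inverse to each other.\<close>

lemma separates_no_inverse:
  assumes cs: "set cs \<subseteq> carrier R" and t: "t \<in> poly_ideal R cs" and z: "z \<in> recip_diffs R cs"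
  shows "t \<otimes> z \<noteq> \<one>"
proof (cases "t = \<zero>")
  case True
  then show ?thesis using z recip_diffs_carrier[of cs] one_not_zero by (auto simp: subset_iff)
next
  case False
  then have "\<one> \<oplus> (t \<otimes> \<zero> \<oplus> t \<otimes> \<zero>) \<noteq> t \<otimes> z"
    using t z zero_recip_diffs[OF cs] unfolding poly_ideal_def separates_def by blast
  then show ?thesis using t by (simp add: poly_ideal_def)
qed

lemma poly_ideal_carrier: "poly_ideal R cs \<subseteq> carrier R"
  by (auto simp: poly_ideal_def)

lemma poly_ideal_subset_poly_ring:
  assumes cs: "set cs \<subseteq> carrier R"
  shows "poly_ideal R cs \<subseteq> poly_ring_of R cs"
proof
  fix t assume t: "t \<in> poly_ideal R cs"
  have "t \<otimes> y \<noteq> \<one>" if "y \<in> poly_ideal R cs" for y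
    by (rule separates_no_inverse[OF cs t]) (use that poly_ideal_subset_recip_diffs[OF cs] in blast)
  then show "t \<in> poly_ring_of R cs" using t poly_ideal_carrier by (auto simp: poly_ring_of_def)
qed

lemma poly_ring_of_iff:
  "x \<in> poly_ring_of R cs \<longleftrightarrow> x \<in> carrier R \<and> (x = \<zero> \<or> inv x \<notin> poly_ideal R cs)"
proof (cases "x \<in> carrier R \<and> x \<noteq> \<zero>")
  case True
  then have "x \<otimes> y = \<one> \<longleftrightarrow> y = inv x" if "y \<in> carrier R" for y
    using that inv_eqI(3)[of x y] nonzero_inv[of x] by auto
  then show ?thesis using True poly_ideal_carrier[of cs] by (auto simp: poly_ring_of_def)
next
  case False
  then show ?thesis using poly_ideal_carrier[of cs] one_not_zero
    by (auto simp: poly_ring_of_def subset_iff)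
qed

text \<open>Closure under sums and products is part of \<open>admissible\<close>. An element outside
  \<open>poly_ring_of R cs\<close> has its inverse in \<open>poly_ideal R cs\<close>, hence in
  \<open>poly_ring_of R cs\<close>; and 1 is its own inverse but not in the ideal.\<close>

lemma admissible_valuation_subring:
  assumes cs: "set cs \<subseteq> carrier R" and adm: "admissible R cs"
  shows "valuation_subring R (poly_ring_of R cs)"
    and "valuation_subring.N R (poly_ring_of R cs) = poly_ideal R cs"
proof -
  have "\<one> \<notin> poly_ideal R cs"
    using separates_no_inverse[OF cs, of \<one> \<one>] poly_ideal_subset_recip_diffs[OF cs] by auto
  then have one: "\<one> \<in> poly_ring_of R cs" by (simp add: poly_ring_of_iff)
  show V: "valuation_subring R (poly_ring_of R cs)"
  proof (unfold_locales)
    fix x assume x: "x \<in> carrier R" "x \<noteq> \<zero>" "x \<notin> poly_ring_of R cs"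
    then have "inv x \<in> poly_ideal R cs" by (simp add: poly_ring_of_iff)
    then show "inv x \<in> poly_ring_of R cs" using poly_ideal_subset_poly_ring[OF cs] by blast
  next
    show "poly_ring_of R cs \<subseteq> carrier R" by (auto simp: poly_ring_of_def)
  qed (use one adm in \<open>auto simp: admissible_def\<close>)
  show "valuation_subring.N R (poly_ring_of R cs) = poly_ideal R cs"
  proof (rule Set.set_eqI)
    fix x
    show "x \<in> valuation_subring.N R (poly_ring_of R cs) \<longleftrightarrow> x \<in> poly_ideal R cs"
    proof (cases "x \<in> carrier R \<and> x \<noteq> \<zero>")
      case True
      then show ?thesis using nonzero_inv[of x]
        by (simp add: valuation_subring.N_def[OF V] poly_ring_of_iff)
    next
      case False
      then show ?thesis by (auto simp: valuation_subring.N_def[OF V] poly_ideal_def)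
    qed
  qed
qed

end

context valuation_subring
begin

lemma recip_vals_A:
  assumes cs: "set cs \<subseteq> carrier R" and nr: "\<And>x. x \<in> carrier R \<Longrightarrow> monic_val R cs x \<notin> N"
    and u: "u \<in> recip_vals R cs"
  shows "u \<in> A"
proof -
  consider "u = \<zero>" | x where "u \<in> carrier R" "x \<in> carrier R" "u \<otimes> monic_val R cs x = \<one>"
    using u recip_vals_iff[OF cs] by blast
  then show ?thesis
  proof cases
    case 2
    have c: "monic_val R cs x \<in> carrier R" using 2 cs monic_val_closed by blast
    have "inv (monic_val R cs x) = u" using inv_eqI(4) 2 c by blast
    then show ?thesis using inv_unit_A[OF c nr] 2 by blast
  qed (simp add: zero_A)
qed

lemma recip_diffs_A:
  assumes "set cs \<subseteq> carrier R" and "\<And>x. x \<in> carrier R \<Longrightarrow> monic_val R cs x \<notin> N"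
  shows "recip_diffs R cs \<subseteq> A"
  using recip_vals_A[OF assms] minus_A by (auto simp: recip_diffs_def a_minus_def)

lemma monic_val_not_N:
  assumes cs: "set cs \<subseteq> A" "cs \<noteq> []" and nr: "\<And>x. x \<in> A \<Longrightarrow> monic_val R cs x \<notin> N"
    and x: "x \<in> carrier R"
  shows "monic_val R cs x \<notin> N"
  using monic_val_notin_A[OF x _ cs] nr N_A by blast

text \<open>Both t D and t + t D are contained in \<open>N\<close>, hence in \<open>D\<close>, and
  no element of 1 + \<open>N\<close> lies in \<open>N\<close>.\<close>

lemma N_contracts_separates:
  assumes D: "N \<subseteq> D" "D \<subseteq> A" and t: "t \<in> N" "t \<noteq> \<zero>"
  shows "contracts R D t" "separates R D t"
proof -
  have tx: "t \<otimes> x \<in> N" if "x \<in> D" for x using mult_N'[OF t(1)] that D by blast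
  show "contracts R D t"
    unfolding contracts_def using tx add_N[OF t(1)] t D(1) by blast
  show "separates R D t"
    unfolding separates_def
  proof (intro ballI notI)
    fix x y z assume "x \<in> D" "y \<in> D" "z \<in> D" and eq: "\<one> \<oplus> (t \<otimes> x \<oplus> t \<otimes> y) = t \<otimes> z"
    then have "\<one> \<oplus> (t \<otimes> x \<oplus> t \<otimes> y) \<notin> N"
      using add_notin_N[OF one_closed one_not_N] add_N tx by blast
    then show False using eq tx \<open>z \<in> D\<close> by simp
  qed
qed

end

section \<open>Henselian valuation subrings\<close>

text \<open>Hensel's lemma for monic polynomials at the point 0: the conditions on
  \<open>cs ! 0\<close> and \<open>cs ! 1\<close> say that 0 is a simple zero of the residue
  polynomial.\<close>

locale henselian_subring = valuation_subring +
  assumes henselian: "\<lbrakk>set cs \<subseteq> A; 2 \<le> length cs; cs ! 0 \<in> N; cs ! 1 \<notin> N\<rbrakk> \<Longrightarrow>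
    \<exists>x\<in>A. monic_val R cs x = \<zero>"
begin

text \<open>An element e of \<open>N\<close> is the difference of w + e and w = 1 / f 0. The first
  is also of the form 1 / f x: f - 1 / (w + e) has its constant coefficient in \<open>N\<close> and
  its linear one outside, so Hensel's lemma yields a zero x.\<close>

lemma N_subset_recip_diffs:
  assumes cs: "set cs \<subseteq> A" "2 \<le> length cs"
    and nr: "\<And>x. x \<in> A \<Longrightarrow> monic_val R cs x \<notin> N" and lin: "cs ! 1 \<notin> N"
  shows "N \<subseteq> recip_diffs R cs"
proof
  fix e assume e: "e \<in> N"
  obtain c cs' where cs': "cs = c # cs'" using cs(2) by (cases cs) auto
  have cA: "c \<in> A" and csA: "set cs' \<subseteq> A" using cs cs' by auto
  have carr: "set cs \<subseteq> carrier R" "set cs' \<subseteq> carrier R" using cs csA A_sub by auto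
  have val0: "monic_val R cs \<zero> = c"
    using monic_val_closed[OF carr(2), of \<zero>] A_carrier[OF cA] by (simp add: cs')
  have cN: "c \<notin> N" using nr[OF zero_A] val0 by simp
  define w where "w = inv c"
  have w: "w \<in> A" "w \<otimes> c = \<one>" "w \<in> carrier R"
    using inv_unit_A[OF A_carrier[OF cA] cN] nonzero_inv[of c] A_carrier[OF cA] by (auto simp: w_def)
  have "w \<notin> N" using mult_N[OF cA, of w] w one_not_N A_carrier[OF cA] by (auto simp: m_comm)
  then have uN: "w \<oplus> e \<notin> N" using add_notin_N w(3) e by blast
  define u where "u = w \<oplus> e"
  have u: "u \<in> carrier R" using w N_carrier[OF e] by (simp add: u_def)
  \<comment> \<open>\<open>k\<close> is the value that f must take at x for \<open>u\<close> to be 1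
    / f x.\<close>
  define k where "k = inv u"
  have k: "k \<in> A" "k \<in> carrier R" "u \<otimes> k = \<one>"
    using inv_unit_A[OF u uN[folded u_def]] nonzero_inv[OF u] A_carrier by (auto simp: k_def)
  have "c \<ominus> k = k \<otimes> (c \<otimes> e)"
  proof -
    have "c \<ominus> k = c \<otimes> (u \<otimes> k) \<ominus> (w \<otimes> c) \<otimes> k" using k w A_carrier[OF cA] by simp
    also have "\<dots> = k \<otimes> (c \<otimes> e)"
      unfolding u_def using k(2) w(3) A_carrier[OF cA] N_carrier[OF e] by algebra
    finally show ?thesis .
  qed
  then have "c \<ominus> k \<in> N" using mult_N[OF k(1) mult_N[OF cA e]] by simp
  moreover have "((c \<ominus> k) # cs') ! 1 \<notin> N" using lin by (simp add: cs')
  ultimately obtain x where x: "x \<in> A" "monic_val R ((c \<ominus> k) # cs') x = \<zero>"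
    using henselian[of "(c \<ominus> k) # cs'"] cs cs' csA minus_A[OF cA k(1)] by auto
  have xc: "x \<in> carrier R" "monic_val R cs' x \<in> carrier R"
    using x(1) A_carrier monic_val_closed[OF carr(2)] by auto
  have "monic_val R cs x = monic_val R ((c \<ominus> k) # cs') x \<oplus> k"
    using xc k(2) A_carrier[OF cA] unfolding cs' by simp algebra
  then have "monic_val R cs x = k" using x k by simp
  then have "u \<in> recip_vals R cs" using recip_vals_iff[OF carr(1)] u k(3) xc(1) by blast
  moreover have "w \<in> recip_vals R cs" using recip_vals_iff[OF carr(1)] w val0 by (metis zero_closed)
  ultimately have "u \<ominus> w \<in> recip_diffs R cs" by (rule minus_recip_diffs)
  moreover have "u \<ominus> w = e" unfolding u_def using w(3) N_carrier[OF e] by algebra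
  ultimately show "e \<in> recip_diffs R cs" by simp
qed

end

text \<open>
  Both cases use a suitable multiple of \<open>a\<close> of the form \<open>a / (1 + s)\<close>, where \<open>s\<close> lies in the
  maximal ideal of \<open>B\<close> and has a pole for \<open>A\<close>.
\<close>

lemma (in valuation_subring) exists_approximation:
  assumes B: "valuation_subring R B" and p: "p \<in> B" "p \<notin> A" and q: "q \<in> A" "q \<notin> B"
    and a: "a \<in> B"
  shows "\<exists>b\<in>N. b \<in> B \<and> b \<ominus> a \<in> valuation_subring.N R B"
proof -
  interpret B: valuation_subring R B by (rule B)
  have ac: "a \<in> carrier R" and pc: "p \<in> carrier R" and qc: "q \<in> carrier R"
    using a p q A_carrier B.A_carrier by auto
  \<comment> \<open>\<open>t\<close> lies in the maximal ideal of \<open>B\<close>, as 1 / q does,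
    while 1 / t lies in that of \<open>A\<close>, as 1 / p does.\<close>
  define t where "t = p \<otimes> inv q"
  have iq: "q \<noteq> \<zero>" "inv q \<in> B.N" using B.inv_notin_A[OF qc q(2)] by auto
  have ip: "p \<noteq> \<zero>" "inv p \<in> N" using inv_notin_A[OF pc p(2)] by auto
  have tN: "t \<in> B.N" unfolding t_def by (rule B.mult_N[OF p(1) iq(2)])
  have tc: "t \<in> carrier R" by (rule B.N_carrier[OF tN])
  have "t \<otimes> (q \<otimes> inv p) = (p \<otimes> inv p) \<otimes> (q \<otimes> inv q)"
    unfolding t_def using pc qc N_carrier[OF ip(2)] B.N_carrier[OF iq(2)] by (simp add: m_ac)
  then have "t \<otimes> (q \<otimes> inv p) = \<one>" using pc qc iq ip nonzero_inv by simp
  then have it: "inv t = q \<otimes> inv p" "t \<noteq> \<zero>"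
    using inv_eqI[OF tc, of "q \<otimes> inv p"] qc N_carrier[OF ip(2)] by auto
  have itN: "inv t \<in> N" unfolding it by (rule mult_N[OF q(1) ip(2)])
  have tA: "t \<notin> A" using itN by (simp add: N_def nonzero_inv(2,5)[OF tc it(2)])
  \<comment> \<open>Up to sign, a / (1 + s) differs from a by s a / (1 + s), which lies in
    \<open>B.N\<close>.\<close>
  have main: "\<exists>b\<in>N. b \<in> B \<and> b \<ominus> a \<in> B.N"
    if s: "s \<in> B.N" and bN: "a \<otimes> inv (\<one> \<oplus> s) \<in> N" for s
  proof (intro bexI conjI)
    have sc: "s \<in> carrier R" by (rule B.N_carrier[OF s])
    have "\<one> \<oplus> s \<notin> B.N" by (rule B.add_notin_N[OF one_closed B.one_not_N s])
    then have i: "inv (\<one> \<oplus> s) \<in> B" "\<one> \<oplus> s \<noteq> \<zero>"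
      using B.inv_unit_A[of "\<one> \<oplus> s"] sc by auto
    show bB: "a \<otimes> inv (\<one> \<oplus> s) \<in> B" by (rule B.mult_A[OF a i(1)])
    define r where "r = inv (\<one> \<oplus> s)"
    have r: "r \<in> carrier R" "(\<one> \<oplus> s) \<otimes> r = \<one>"
      using i sc nonzero_inv[of "\<one> \<oplus> s"] by (auto simp: r_def)
    have "a \<otimes> r \<ominus> a = a \<otimes> r \<ominus> a \<otimes> ((\<one> \<oplus> s) \<otimes> r)" using r ac by simp
    also have "\<dots> = (\<ominus> (a \<otimes> r)) \<otimes> s" using r(1) ac sc by algebra
    also have "\<dots> \<in> B.N" by (rule B.mult_N[OF B.neg_A[OF bB[folded r_def]] s])
    finally show "a \<otimes> inv (\<one> \<oplus> s) \<ominus> a \<in> B.N" by (simp add: r_def)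
    show "a \<otimes> inv (\<one> \<oplus> s) \<in> N" by (rule bN)
  qed
  show ?thesis
  \<comment> \<open>For a in \<open>A\<close> take s = t, since 1 + t is outside \<open>A\<close>.
    Otherwise take s = a t: then a / (1 + s) = 1 / (1 / a + t), where 1 / a is in \<open>N\<close>
    and t is outside \<open>A\<close>.\<close>
  proof (cases "a \<in> A")
    case True
    have "t \<oplus> \<one> \<notin> A" by (rule add_notin_A(1)[OF tc tA one_A])
    then have "inv (\<one> \<oplus> t) \<in> N" using inv_notin_A[of "\<one> \<oplus> t"] tc by (simp add: a_comm)
    then show ?thesis using main[OF tN] mult_N[OF True] by blast
  next
    case False
    have ia: "a \<noteq> \<zero>" "inv a \<in> N" using inv_notin_A[OF ac False] by auto
    have iac: "inv a \<in> carrier R" by (rule N_carrier[OF ia(2)])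
    have nA: "inv a \<oplus> t \<notin> A" by (rule add_notin_A(2)[OF tc tA N_A[OF ia(2)]])
    have nz: "inv a \<oplus> t \<noteq> \<zero>" "inv (inv a \<oplus> t) \<in> N"
      using inv_notin_A[OF _ nA] iac tc by auto
    define z where "z = inv (inv a \<oplus> t)"
    have z: "z \<in> carrier R" "(inv a \<oplus> t) \<otimes> z = \<one>"
      using nonzero_inv(1,3)[OF _ nz(1)] iac tc by (auto simp: z_def)
    have sc: "\<one> \<oplus> a \<otimes> t \<in> carrier R" using ac tc by simp
    have e1: "a \<otimes> (inv a \<oplus> t) = \<one> \<oplus> a \<otimes> t"
      using ac tc iac nonzero_inv(3)[OF ac ia(1)] by (simp add: r_distr)
    have "(\<one> \<oplus> a \<otimes> t) \<otimes> (inv a \<otimes> z) = (a \<otimes> inv a) \<otimes> ((inv a \<oplus> t) \<otimes> z)"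
      unfolding e1[symmetric] using ac tc iac z(1) by (simp add: m_ac)
    then have "(\<one> \<oplus> a \<otimes> t) \<otimes> (inv a \<otimes> z) = \<one>" using z nonzero_inv(3)[OF ac ia(1)] by simp
    then have "inv (\<one> \<oplus> a \<otimes> t) = inv a \<otimes> z" using inv_eqI(3)[OF sc] iac z(1) by blast
    then have "a \<otimes> inv (\<one> \<oplus> a \<otimes> t) = z"
      using ac iac z(1) nonzero_inv(3)[OF ac ia(1)] by (simp add: m_assoc[symmetric])
    then have "a \<otimes> inv (\<one> \<oplus> a \<otimes> t) \<in> N" using nz(2) by (simp add: z_def)
    then show ?thesis using main[OF B.mult_N[OF a tN]] by blast
  qed
qed

text \<open>
  Otherwise the polynomial could be modified modulo the maximal ideal of \<open>B\<close> so that it becomes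
  congruent to \<open>X\<^sup>d + X\<close> modulo that of \<open>A\<close>, hence acquires a root.
\<close>

lemma (in henselian_subring) comparable:
  assumes B: "valuation_subring R B" and cs: "set cs \<subseteq> B" "2 \<le> length cs"
    and nr: "\<And>x. x \<in> B \<Longrightarrow> monic_val R cs x \<notin> valuation_subring.N R B"
  shows "A \<subseteq> B \<or> B \<subseteq> A"
proof (rule ccontr)
  interpret B: valuation_subring R B by (rule B)
  assume "\<not> (A \<subseteq> B \<or> B \<subseteq> A)"
  then obtain p q where pq: "p \<in> B" "p \<notin> A" "q \<in> A" "q \<notin> B" by blast
  have *: "\<exists>b\<in>N. b \<in> B \<and> b \<ominus> a \<in> B.N" if "a \<in> B" for a
    by (rule exists_approximation[OF B pq that])
  \<comment> \<open>For i = 1, the new coefficient is 1 plus an approximation in \<open>N\<close> of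
    \<open>cs ! 1 \<ominus> \<one>\<close>; the others are approximations in \<open>N\<close>
    themselves.\<close>
  have "\<exists>b. b \<in> A \<and> b \<in> B \<and> b \<ominus> cs ! i \<in> B.N \<and> (i = 0 \<longrightarrow> b \<in> N) \<and> (i = 1 \<longrightarrow> b \<notin> N)"
    if i: "i < length cs" for i
  proof (cases "i = 1")
    case True
    have a: "cs ! i \<in> B" using cs i by auto
    then obtain b where b: "b \<in> N" "b \<in> B" "b \<ominus> (cs ! i \<ominus> \<one>) \<in> B.N"
      using *[of "cs ! i \<ominus> \<one>"] B.minus_A[OF _ B.one_A] by blast
    have "(\<one> \<oplus> b) \<ominus> cs ! i = b \<ominus> (cs ! i \<ominus> \<one>)"
      using N_carrier[OF b(1)] B.A_carrier[OF a] by algebra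
    then have "(\<one> \<oplus> b) \<ominus> cs ! i \<in> B.N" using b(3) by simp
    then show ?thesis using True b add_A[OF one_A N_A[OF b(1)]] B.add_A[OF B.one_A b(2)]
        add_notin_N[OF one_closed one_not_N b(1)]
      by (intro exI[of _ "\<one> \<oplus> b"]) auto
  next
    case False
    have "cs ! i \<in> B" using cs i by auto
    then show ?thesis using *[of "cs ! i"] False N_A by blast
  qed
  then obtain b where b: "\<And>i. i < length cs \<Longrightarrow>
      b i \<in> A \<and> b i \<in> B \<and> b i \<ominus> cs ! i \<in> B.N \<and> (i = 0 \<longrightarrow> b i \<in> N) \<and> (i = 1 \<longrightarrow> b i \<notin> N)"
    by metis
  define bs where "bs = map b [0..<length cs]"
  have bsA: "set bs \<subseteq> A" and bsB: "set bs \<subseteq> B" and len: "length bs = length cs"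
    using b by (auto simp: bs_def)
  have "0 < length cs" "1 < length cs" using cs(2) by linarith+
  then have "bs ! 0 \<in> N" "bs ! 1 \<notin> N" using b[of 0] b[of 1] by (simp_all add: bs_def)
  then obtain x where x: "x \<in> A" "monic_val R bs x = \<zero>" using henselian[OF bsA] cs(2) len by auto
  \<comment> \<open>The modified polynomial is monic over \<open>B\<close> as well, so it has no
    zeros outside \<open>B\<close>.\<close>
  have "x \<in> B"
    using B.monic_val_notin_A[of x bs] A_carrier[OF x(1)] bsB x(2) B.zero_A cs(2) len by fastforce
  moreover have "list_all2 (\<lambda>b c. b \<in> B \<and> b \<ominus> c \<in> B.N) bs cs"
    using b by (auto simp: bs_def list_all2_conv_all_nth)
  ultimately have "monic_val R bs x \<ominus> monic_val R cs x \<in> B.N"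
    using B.monic_val_cong cs(1) by blast
  then have "\<ominus> (monic_val R bs x \<ominus> monic_val R cs x) \<in> B.N" by (rule B.neg_N)
  moreover have "\<ominus> (monic_val R bs x \<ominus> monic_val R cs x) = monic_val R cs x"
    using x(2) B.A_carrier[OF B.monic_val_A[OF cs(1) \<open>x \<in> B\<close>]] by (simp add: a_minus_def)
  ultimately show False using nr[OF \<open>x \<in> B\<close>] by simp
qed

section \<open>Residue maps\<close>

locale residue_map = valuation_subring R A + F: field F
  for R :: "('a, 'b) ring_scheme" (structure) and A and F :: "('c, 'd) ring_scheme" and h +
  assumes h_image: "h ` A = carrier F"
    and h_one: "h \<one> = \<one>\<^bsub>F\<^esub>"
    and h_add: "\<lbrakk>a \<in> A; b \<in> A\<rbrakk> \<Longrightarrow> h (a \<oplus> b) = h a \<oplus>\<^bsub>F\<^esub> h b"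
    and h_mult: "\<lbrakk>a \<in> A; b \<in> A\<rbrakk> \<Longrightarrow> h (a \<otimes> b) = h a \<otimes>\<^bsub>F\<^esub> h b"
    and h_zero_iff: "a \<in> A \<Longrightarrow> h a = \<zero>\<^bsub>F\<^esub> \<longleftrightarrow> a \<in> N"
begin

lemma h_closed: "a \<in> A \<Longrightarrow> h a \<in> carrier F"
  using h_image by blast

lemma h_zero: "h \<zero> = \<zero>\<^bsub>F\<^esub>"
  using h_zero_iff[OF zero_A] zero_N by simp

lemma h_neg: assumes "a \<in> A" shows "h (\<ominus> a) = \<ominus>\<^bsub>F\<^esub> h a"
proof -
  have "h (\<ominus> a) \<oplus>\<^bsub>F\<^esub> h a = \<zero>\<^bsub>F\<^esub>"
    using h_add[OF neg_A[OF assms] assms] A_carrier[OF assms] h_zero by (simp add: l_neg)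
  then show ?thesis using F.minus_equality h_closed neg_A assms by metis
qed

lemma h_monic_val:
  "\<lbrakk>set cs \<subseteq> A; x \<in> A\<rbrakk> \<Longrightarrow> h (monic_val R cs x) = monic_val F (map h cs) (h x)"
  by (induction cs) (auto simp: h_one h_add h_mult mult_A monic_val_A)

text \<open>If u = 1 / f x has nonzero residue, then f x lies in \<open>A\<close>, hence so does x,
  and the equation passes to the residue field; if the residue is 0, it belongs to the right-hand
  side anyway. Conversely, f x is a unit for every lift x of a point of the residue field.\<close>

lemma h_recip_vals:
  assumes cs: "set cs \<subseteq> A" "cs \<noteq> []" and nr: "\<And>x. x \<in> A \<Longrightarrow> monic_val R cs x \<notin> N"
  shows "h ` recip_vals R cs = recip_vals F (map h cs)"
proof -
  have carr: "set cs \<subseteq> carrier R" "set (map h cs) \<subseteq> carrier F"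
    using cs A_sub h_closed by auto
  have nr': "monic_val R cs x \<notin> N" if "x \<in> carrier R" for x
    using monic_val_not_N[OF cs nr that] .
  have uA: "u \<in> A" if "u \<in> recip_vals R cs" for u using recip_vals_A[OF carr(1) nr' that] .
  show ?thesis
  proof (intro equalityI subsetI)
    fix u' assume "u' \<in> h ` recip_vals R cs"
    then obtain u where u: "u \<in> recip_vals R cs" "u' = h u" by blast
    show "u' \<in> recip_vals F (map h cs)"
    proof (cases "h u = \<zero>\<^bsub>F\<^esub>")
      case False
      then have "u \<noteq> \<zero>" "u \<notin> N" using h_zero h_zero_iff[OF uA[OF u(1)]] by auto
      then obtain x where x: "u \<in> carrier R" "x \<in> carrier R" "u \<otimes> monic_val R cs x = \<one>"
        using u(1) recip_vals_iff[OF carr(1)] by blast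
      have "inv u = monic_val R cs x" using inv_eqI(3)[of u] x monic_val_closed[OF carr(1)] by blast
      then have "monic_val R cs x \<in> A" using inv_unit_A[OF x(1) \<open>u \<notin> N\<close>] by simp
      then have xA: "x \<in> A" using monic_val_notin_A[OF x(2) _ cs] by blast
      have "h u \<otimes>\<^bsub>F\<^esub> monic_val F (map h cs) (h x) = \<one>\<^bsub>F\<^esub>"
        using h_mult[OF uA[OF u(1)] monic_val_A[OF cs(1) xA]] h_monic_val[OF cs(1) xA] x(3) h_one
        by simp
      then show ?thesis
        using F.recip_vals_iff[OF carr(2)] u(2) h_closed[OF uA[OF u(1)]] h_closed[OF xA] by blast
    qed (use u F.zero_recip_vals[OF carr(2)] in simp)
  next
    fix u' assume u': "u' \<in> recip_vals F (map h cs)"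
    show "u' \<in> h ` recip_vals R cs"
    proof (cases "u' = \<zero>\<^bsub>F\<^esub>")
      case True
      then show ?thesis using zero_recip_vals[OF carr(1)] h_zero by force
    next
      case False
      then obtain x' where x': "u' \<in> carrier F" "x' \<in> carrier F"
          "u' \<otimes>\<^bsub>F\<^esub> monic_val F (map h cs) x' = \<one>\<^bsub>F\<^esub>"
        using u' F.recip_vals_iff[OF carr(2)] by blast
      obtain x where x: "x \<in> A" "x' = h x" using x'(2) h_image by blast
      define f where "f = monic_val R cs x"
      have f: "f \<in> A" "f \<notin> N" "f \<in> carrier R"
        using monic_val_A[OF cs(1) x(1)] nr[OF x(1)] A_carrier by (auto simp: f_def)
      have i: "inv f \<in> A" "inv f \<otimes> f = \<one>" "inv f \<in> carrier R"
        using inv_unit_A[OF f(3,2)] nonzero_inv[OF f(3)] by auto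
      have "h (inv f) \<otimes>\<^bsub>F\<^esub> h f = \<one>\<^bsub>F\<^esub>" using h_mult[OF i(1) f(1)] i h_one by simp
      moreover have hf: "h f = monic_val F (map h cs) x'" using h_monic_val[OF cs(1) x(1)] x f_def by simp
      ultimately have "h (inv f) = u'"
        using F.inv_eqI(4)[of u' "h f"] F.inv_eqI(4)[of "h (inv f)" "h f"] x' h_closed[OF f(1)] h_closed[OF i(1)]
        by metis
      moreover have "inv f \<in> recip_vals R cs"
        using recip_vals_iff[OF carr(1)] i A_carrier[OF x(1)] f_def by blast
      ultimately show ?thesis by blast
    qed
  qed
qed

lemma h_recip_diffs:
  assumes cs: "set cs \<subseteq> A" "cs \<noteq> []" and nr: "\<And>x. x \<in> A \<Longrightarrow> monic_val R cs x \<notin> N"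
  shows "h ` recip_diffs R cs = recip_diffs F (map h cs)"
proof -
  have carr: "set cs \<subseteq> carrier R" using cs A_sub by auto
  have nr': "monic_val R cs x \<notin> N" if "x \<in> carrier R" for x
    using monic_val_not_N[OF cs nr that] .
  have uA: "u \<in> A" if "u \<in> recip_vals R cs" for u using recip_vals_A[OF carr nr' that] .
  have hd: "h (u \<oplus> \<ominus> w) = h u \<oplus>\<^bsub>F\<^esub> \<ominus>\<^bsub>F\<^esub> h w"
    if "u \<in> recip_vals R cs" "w \<in> recip_vals R cs" for u w
    using that uA by (simp add: h_add h_neg neg_A)
  have im: "recip_vals F (map h cs) = h ` recip_vals R cs"
    using h_recip_vals[OF cs nr] by simp
  show ?thesis
    unfolding recip_diffs_image F.recip_diffs_image im
  proof (intro equalityI subsetI)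
    fix z assume "z \<in> h ` (\<lambda>(u, w). u \<oplus> \<ominus> w) ` (recip_vals R cs \<times> recip_vals R cs)"
    then obtain u w where "u \<in> recip_vals R cs" "w \<in> recip_vals R cs" "z = h (u \<oplus> \<ominus> w)" by auto
    then show "z \<in> (\<lambda>(u, w). u \<oplus>\<^bsub>F\<^esub> \<ominus>\<^bsub>F\<^esub> w) ` (h ` recip_vals R cs \<times> h ` recip_vals R cs)"
      using hd by (intro image_eqI[of _ _ "(h u, h w)"]) auto
  next
    fix z assume "z \<in> (\<lambda>(u, w). u \<oplus>\<^bsub>F\<^esub> \<ominus>\<^bsub>F\<^esub> w) ` (h ` recip_vals R cs \<times> h ` recip_vals R cs)"
    then obtain u w where "u \<in> recip_vals R cs" "w \<in> recip_vals R cs"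
      "z = h u \<oplus>\<^bsub>F\<^esub> \<ominus>\<^bsub>F\<^esub> h w" by auto
    then show "z \<in> h ` (\<lambda>(u, w). u \<oplus> \<ominus> w) ` (recip_vals R cs \<times> recip_vals R cs)"
      using hd by (intro image_eqI[of _ _ "u \<oplus> \<ominus> w"]) auto
  qed
qed

lemma contracts_separates_residue:
  assumes D: "N \<subseteq> D" "D \<subseteq> A" and t: "t \<in> A" "t \<notin> N"
    and ct: "contracts R D t" "separates R D t"
  shows "contracts F (h ` D) (h t)" "weakly_separates F (h ` D) (h t)"
proof -
  show "contracts F (h ` D) (h t)"
    unfolding contracts_def
  proof (intro conjI ballI)
    show "h t \<noteq> \<zero>\<^bsub>F\<^esub>" using t h_zero_iff by simp
    fix x' assume "x' \<in> h ` D"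
    then obtain x where x: "x \<in> D" "x' = h x" by blast
    then have "t \<otimes> x \<in> D" "t \<oplus> t \<otimes> x \<in> D" using ct(1) by (auto simp: contracts_def)
    moreover have "h (t \<otimes> x) = h t \<otimes>\<^bsub>F\<^esub> x'" "h (t \<oplus> t \<otimes> x) = h t \<oplus>\<^bsub>F\<^esub> h t \<otimes>\<^bsub>F\<^esub> x'"
      using x D t by (auto simp: h_mult h_add mult_A subset_iff)
    ultimately show "h t \<otimes>\<^bsub>F\<^esub> x' \<in> h ` D" "h t \<oplus>\<^bsub>F\<^esub> h t \<otimes>\<^bsub>F\<^esub> x' \<in> h ` D" by force+
  qed
  show "weakly_separates F (h ` D) (h t)"
    unfolding weakly_separates_def
  proof (intro ballI notI)
    fix x' z' assume "x' \<in> h ` D" "z' \<in> h ` D"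
      and eq: "\<one>\<^bsub>F\<^esub> \<oplus>\<^bsub>F\<^esub> h t \<otimes>\<^bsub>F\<^esub> x' = h t \<otimes>\<^bsub>F\<^esub> z'"
    then obtain x z where x: "x \<in> D" "x \<in> A" "x' = h x" and z: "z \<in> D" "z \<in> A" "z' = h z"
      using D(2) by blast
    define e where "e = (\<one> \<oplus> t \<otimes> x) \<ominus> t \<otimes> z"
    have eA: "e \<in> A" using x z t by (simp add: e_def minus_A add_A one_A mult_A)
    have "h e = (\<one>\<^bsub>F\<^esub> \<oplus>\<^bsub>F\<^esub> h t \<otimes>\<^bsub>F\<^esub> x') \<oplus>\<^bsub>F\<^esub> \<ominus>\<^bsub>F\<^esub> (h t \<otimes>\<^bsub>F\<^esub> z')"
      using x z t by (simp add: e_def a_minus_def h_add h_mult h_neg h_one add_A mult_A one_A neg_A)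
    then have "h e = \<zero>\<^bsub>F\<^esub>" using eq h_closed[OF t(1)] h_closed[OF z(2)] z(3) by (simp add: F.r_neg)
    then have eN: "e \<in> N" using h_zero_iff[OF eA] by simp
    have it: "inv t \<in> A" "t \<otimes> inv t = \<one>" "inv t \<in> carrier R" "t \<in> carrier R"
      using inv_unit_A[OF A_carrier[OF t(1)] t(2)] nonzero_inv[OF A_carrier[OF t(1)]] A_carrier[OF t(1)]
      by auto
    \<comment> \<open>Lifting the equation leaves an error \<open>e\<close> in \<open>N\<close>. The
      element \<open>y\<close> absorbs it: t y = - e, and \<open>y\<close> lies in \<open>N\<close>,
      hence in \<open>D\<close>.\<close>
    define y where "y = \<ominus> (inv t \<otimes> e)"
    have yD: "y \<in> D" using neg_N[OF mult_N[OF it(1) eN]] D(1) by (auto simp: y_def)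
    have c: "e \<in> carrier R" "x \<in> carrier R" "z \<in> carrier R" using eN N_carrier x z A_carrier by auto
    have "t \<otimes> y = \<ominus> ((t \<otimes> inv t) \<otimes> e)" unfolding y_def using it(3,4) c by algebra
    then have ty: "t \<otimes> y = \<ominus> e" using it c by simp
    have "\<one> \<oplus> (t \<otimes> x \<oplus> t \<otimes> y) = t \<otimes> z"
      unfolding ty e_def using it(4) c(2,3) by algebra
    then show False using ct(2) x(1) yD z(1) unfolding separates_def by blast
  qed
qed

end

section \<open>Definition of the maximal ideal\<close>

text \<open>The hypothesis \<open>no_contraction\<close> is what simplicity of \<open>F\<close>
  contributes to the argument.\<close>

locale henselian_residue = henselian_subring R A + residue_map R A F h
  for R :: "('a, 'b) ring_scheme" (structure) and A and F :: "('c, 'd) ring_scheme" and h +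
  fixes d :: nat
  assumes two_le_d: "2 \<le> d"
    and no_contraction: "\<lbrakk>cs \<in> tuples F d; t \<in> carrier F; contracts F (recip_diffs F cs) t\<rbrakk> \<Longrightarrow>
      \<not> weakly_separates F (recip_diffs F cs) t"
begin

text \<open>The inclusion of \<open>N\<close> in \<open>recip_diffs R cs\<close> is a hypothesis
  because it has two sources: Hensel's lemma if the linear coefficient is a unit, and a larger
  maximal ideal in the case of an arbitrary admissible polynomial.\<close>

lemma no_contracting_unit:
  assumes cs: "set cs \<subseteq> A" "length cs = d" and nr: "\<And>x. x \<in> A \<Longrightarrow> monic_val R cs x \<notin> N"
    and D: "N \<subseteq> recip_diffs R cs" and t: "t \<in> A" "t \<in> poly_ideal R cs"
  shows "t \<in> N"
proof (rule ccontr)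
  assume tN: "t \<notin> N"
  have cs0: "cs \<noteq> []" using cs(2) two_le_d by auto
  have "t \<noteq> \<zero>" using tN zero_N by auto
  then have ct: "contracts R (recip_diffs R cs) t" "separates R (recip_diffs R cs) t"
    using t(2) by (auto simp: poly_ideal_def)
  have "recip_diffs R cs \<subseteq> A"
    using recip_diffs_A monic_val_not_N[OF cs(1) cs0 nr] cs A_sub by blast
  from contracts_separates_residue[OF D this t(1) tN ct]
  have "contracts F (recip_diffs F (map h cs)) (h t)"
    "weakly_separates F (recip_diffs F (map h cs)) (h t)"
    using h_recip_diffs[OF cs(1) cs0 nr] by auto
  moreover have "map h cs \<in> tuples F d" using cs h_closed by (auto simp: tuples_def)
  ultimately show False using no_contraction h_closed[OF t(1)] by blast
qed

text \<open>The ring \<open>B\<close> defined by the polynomial is comparable with \<open>A\<close>.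
  If it contains \<open>A\<close>, its maximal ideal is contained in \<open>N\<close>. If it is
  contained in \<open>A\<close>, then \<open>N\<close> is contained in \<open>B.N\<close> and so in
  \<open>recip_diffs R cs\<close>, and \<open>no_contracting_unit\<close> applies.\<close>

lemma admissible_poly_ideal_subset:
  assumes cs: "cs \<in> tuples R d" and adm: "admissible R cs"
  shows "poly_ideal R cs \<subseteq> N"
proof
  fix t assume t: "t \<in> poly_ideal R cs"
  have len: "length cs = d" "set cs \<subseteq> carrier R" using cs by (auto simp: tuples_def)
  define B where "B = poly_ring_of R cs"
  interpret B: valuation_subring R B
    unfolding B_def by (rule admissible_valuation_subring(1)[OF len(2) adm])
  have BN: "B.N = poly_ideal R cs"
    unfolding B_def by (rule admissible_valuation_subring(2)[OF len(2) adm])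
  have csB: "set cs \<subseteq> B" "cs \<noteq> []" and nrB: "\<And>x. x \<in> B \<Longrightarrow> monic_val R cs x \<notin> B.N"
    using adm len two_le_d unfolding admissible_def BN by (auto simp: B_def)
  have sub: "B.N \<subseteq> N" if "A \<subseteq> B" using that by (auto simp: B.N_def N_def)
  consider "A \<subseteq> B" | "B \<subseteq> A"
    using comparable[OF B.valuation_subring_axioms csB(1) _ nrB] len two_le_d by auto
  then show "t \<in> N"
  proof cases
    case 1
    then show ?thesis using sub t BN by blast
  next
    case 2
    have NB: "N \<subseteq> B.N" using 2 by (auto simp: B.N_def N_def)
    have nr: "monic_val R cs x \<notin> N" if "x \<in> A" for x
      using B.monic_val_not_N[OF csB nrB] NB A_carrier[OF that] by blast
    have "N \<subseteq> recip_diffs R cs" using NB BN poly_ideal_subset_recip_diffs[OF len(2)] by blast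
    moreover have "t \<in> A" using t BN B.N_A 2 by blast
    ultimately show ?thesis using no_contracting_unit nr csB(1) 2 len(1) t by blast
  qed
qed

lemma poly_ideal_eq_N:
  assumes cs: "set cs \<subseteq> A" "length cs = d" and nr: "\<And>x. x \<in> A \<Longrightarrow> monic_val R cs x \<notin> N"
    and lin: "cs ! 1 \<notin> N"
  shows "poly_ideal R cs = N"
proof -
  have cs0: "cs \<noteq> []" and carr: "set cs \<subseteq> carrier R" using cs two_le_d A_sub by auto
  have D: "N \<subseteq> recip_diffs R cs" using N_subset_recip_diffs[OF cs(1) _ nr lin] cs(2) two_le_d by simp
  have DA: "recip_diffs R cs \<subseteq> A"
    using recip_diffs_A[OF carr] monic_val_not_N[OF cs(1) cs0 nr] by blast
  show ?thesis
  proof (intro equalityI subsetI)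
    fix t assume "t \<in> N"
    then show "t \<in> poly_ideal R cs"
      using N_contracts_separates[OF D DA] N_carrier by (auto simp: poly_ideal_def)
  next
    fix t assume t: "t \<in> poly_ideal R cs"
    then have "t \<in> A" using poly_ideal_subset_recip_diffs[OF carr] DA by blast
    then show "t \<in> N" using no_contracting_unit[OF cs nr D] t by blast
  qed
qed

lemma admissible_if_poly_ideal_eq_N:
  assumes cs: "set cs \<subseteq> A" and nr: "\<And>x. x \<in> A \<Longrightarrow> monic_val R cs x \<notin> N"
    and eq: "poly_ideal R cs = N"
  shows "admissible R cs"
proof -
  have "poly_ring_of R cs = A"
  proof (rule Set.set_eqI)
    fix x show "x \<in> poly_ring_of R cs \<longleftrightarrow> x \<in> A"
      unfolding poly_ring_of_iff eq
      using inv_notin_A[of x] A_carrier[of x] zero_A nonzero_inv[of x] by (auto simp: N_def)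
  qed
  then show ?thesis unfolding admissible_def eq using cs nr add_A mult_A by simp
qed

text \<open>A lift of the given rootless polynomial is admissible and yields exactly
  \<open>N\<close>; every other admissible polynomial yields a subset. So the union over all of them
  is \<open>N\<close>, and \<open>A\<close> consists of the elements without an inverse in
  \<open>N\<close>.\<close>

theorem A_eq:
  assumes "cs \<in> tuples F d" "cs ! 1 \<noteq> \<zero>\<^bsub>F\<^esub>"
    and nr: "\<And>x. x \<in> carrier F \<Longrightarrow> monic_val F cs x \<noteq> \<zero>\<^bsub>F\<^esub>"
  shows "A = {x \<in> carrier R. \<not> (\<exists>y\<in>carrier R. x \<otimes> y = \<one> \<and>
    (\<exists>cs\<in>tuples R d. admissible R cs \<and> y \<in> poly_ideal R cs))}"
proof -
  have "\<exists>as. set as \<subseteq> A \<and> map h as = cs"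
  proof -
    have "\<exists>a. a \<in> A \<and> h a = c" if "c \<in> set cs" for c
    proof -
      have "c \<in> h ` A" using that assms(1) unfolding h_image by (auto simp: tuples_def)
      then show ?thesis by blast
    qed
    then obtain g where "\<And>c. c \<in> set cs \<Longrightarrow> g c \<in> A \<and> h (g c) = c" by metis
    then show ?thesis by (intro exI[of _ "map g cs"]) (auto intro!: map_idI)
  qed
  then obtain as where as: "set as \<subseteq> A" "map h as = cs" by blast
  have len: "length as = d" using assms(1) as(2) by (auto simp: tuples_def)
  have tup: "as \<in> tuples R d" using as len A_sub by (auto simp: tuples_def)
  have nrA: "monic_val R as x \<notin> N" if x: "x \<in> A" for x
    using nr[OF h_closed[OF x]] h_monic_val[OF as(1) x] h_zero_iff[OF monic_val_A[OF as(1) x]] as(2)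
    by simp
  have as1: "as ! 1 \<in> A" "h (as ! 1) = cs ! 1" using as len two_le_d by auto
  have lin: "as ! 1 \<notin> N" using assms(2) as1(2) h_zero_iff[OF as1(1)] by simp
  have eq: "poly_ideal R as = N" by (rule poly_ideal_eq_N[OF as(1) len nrA lin])
  have adm: "admissible R as" by (rule admissible_if_poly_ideal_eq_N[OF as(1) nrA eq])
  have N_iff: "y \<in> N \<longleftrightarrow> (\<exists>cs\<in>tuples R d. admissible R cs \<and> y \<in> poly_ideal R cs)" for y
    using adm tup eq admissible_poly_ideal_subset by blast
  have "x \<in> A \<longleftrightarrow> (\<forall>y\<in>carrier R. x \<otimes> y = \<one> \<longrightarrow> y \<notin> N)" if x: "x \<in> carrier R" for x
  proof
    assume "x \<in> A"
    then show "\<forall>y\<in>carrier R. x \<otimes> y = \<one> \<longrightarrow> y \<notin> N" using mult_N one_not_N by metis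
  next
    assume *: "\<forall>y\<in>carrier R. x \<otimes> y = \<one> \<longrightarrow> y \<notin> N"
    show "x \<in> A"
    proof (rule ccontr)
      assume "x \<notin> A"
      then show False using * inv_notin_A[OF x] nonzero_inv(1,3)[OF x] by blast
    qed
  qed
  then show ?thesis using A_carrier unfolding N_iff[symmetric] by blast
qed

end

section \<open>Formulas\<close>

abbreviation FOr :: "ring_formula \<Rightarrow> ring_formula \<Rightarrow> ring_formula" where
  "FOr \<phi> \<psi> \<equiv> FNot (FAnd (FNot \<phi>) (FNot \<psi>))"

abbreviation FAll :: "nat \<Rightarrow> ring_formula \<Rightarrow> ring_formula" where
  "FAll i \<phi> \<equiv> FNot (FEx i (FNot \<phi>))"

abbreviation FImp :: "ring_formula \<Rightarrow> ring_formula \<Rightarrow> ring_formula" where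
  "FImp \<phi> \<psi> \<equiv> FNot (FAnd \<phi> (FNot \<psi>))"

text \<open>
  Below, \<open>ns\<close> lists the variables for the coefficients, \<open>i\<close> is the variable for the element, and
  the variables from \<open>k\<close> on are bound.
\<close>

primrec poly_term :: "nat list \<Rightarrow> nat \<Rightarrow> ring_term" where
  "poly_term [] i = One"
| "poly_term (n # ns) i = Add (Var n) (Mul (Var i) (poly_term ns i))"

definition recip_vals_fm :: "nat list \<Rightarrow> nat \<Rightarrow> nat \<Rightarrow> ring_formula" where
  "recip_vals_fm ns i k = FEx k (FEq (Mul (Var i) (Mul (Var i) (poly_term ns k))) (Var i))"

definition recip_diffs_fm :: "nat list \<Rightarrow> nat \<Rightarrow> nat \<Rightarrow> ring_formula" where
  "recip_diffs_fm ns i k = FEx k (FEx (k + 1)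
     (FAnd (FAnd (recip_vals_fm ns k (k + 2)) (recip_vals_fm ns (k + 1) (k + 2)))
       (FEq (Var i) (Add (Var k) (Neg (Var (k + 1)))))))"

text \<open>\<open>recip_diffs_fm\<close> takes a variable, not a term, so the two images of x are
  first named by a bound variable. The same device occurs in \<open>admissible_fm\<close>.\<close>

definition contracts_fm :: "nat list \<Rightarrow> nat \<Rightarrow> nat \<Rightarrow> ring_formula" where
  "contracts_fm ns i k = FAnd (FNot (FEq (Var i) Zero)) (FAll k (FImp (recip_diffs_fm ns k (k + 1))
     (FAnd (FEx (k + 1) (FAnd (FEq (Var (k + 1)) (Mul (Var i) (Var k)))
             (recip_diffs_fm ns (k + 1) (k + 2))))
           (FEx (k + 1) (FAnd (FEq (Var (k + 1)) (Add (Var i) (Mul (Var i) (Var k))))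
             (recip_diffs_fm ns (k + 1) (k + 2)))))))"

definition separates_fm :: "nat list \<Rightarrow> nat \<Rightarrow> nat \<Rightarrow> ring_formula" where
  "separates_fm ns i k = FNot (FEx k (FEx (k + 1) (FEx (k + 2)
     (FAnd (FAnd (recip_diffs_fm ns k (k + 3))
              (FAnd (recip_diffs_fm ns (k + 1) (k + 3)) (recip_diffs_fm ns (k + 2) (k + 3))))
       (FEq (Add One (Add (Mul (Var i) (Var k)) (Mul (Var i) (Var (k + 1)))))
         (Mul (Var i) (Var (k + 2))))))))"

definition poly_ideal_fm :: "nat list \<Rightarrow> nat \<Rightarrow> nat \<Rightarrow> ring_formula" where
  "poly_ideal_fm ns i k = FOr (FEq (Var i) Zero) (FAnd (contracts_fm ns i k) (separates_fm ns i k))"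

definition poly_ring_fm :: "nat list \<Rightarrow> nat \<Rightarrow> nat \<Rightarrow> ring_formula" where
  "poly_ring_fm ns i k =
     FNot (FEx k (FAnd (poly_ideal_fm ns k (k + 1)) (FEq (Mul (Var i) (Var k)) One)))"

primrec conj_fm :: "ring_formula list \<Rightarrow> ring_formula" where
  "conj_fm [] = FEq Zero Zero"
| "conj_fm (\<phi> # \<phi>s) = FAnd \<phi> (conj_fm \<phi>s)"

primrec exs_fm :: "nat list \<Rightarrow> ring_formula \<Rightarrow> ring_formula" where
  "exs_fm [] \<phi> = \<phi>"
| "exs_fm (n # ns) \<phi> = FEx n (exs_fm ns \<phi>)"

definition admissible_fm :: "nat list \<Rightarrow> nat \<Rightarrow> ring_formula" where
  "admissible_fm ns k = FAnd (conj_fm (map (\<lambda>n. poly_ring_fm ns n k) ns))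
     (FAnd (FAll k (FImp (poly_ring_fm ns k (k + 1))
             (FAll (k + 1) (FImp (poly_ring_fm ns (k + 1) (k + 2))
               (FAnd (FEx (k + 2) (FAnd (FEq (Var (k + 2)) (Add (Var k) (Var (k + 1))))
                       (poly_ring_fm ns (k + 2) (k + 3))))
                     (FEx (k + 2) (FAnd (FEq (Var (k + 2)) (Mul (Var k) (Var (k + 1))))
                       (poly_ring_fm ns (k + 2) (k + 3)))))))))
           (FAll k (FImp (poly_ring_fm ns k (k + 1))
             (FNot (FEx (k + 1) (FAnd (FEq (Var (k + 1)) (poly_term ns k))
               (poly_ideal_fm ns (k + 1) (k + 2))))))))"

section \<open>Free variables of the formulas\<close>

lemma term_vars_poly_term: "term_vars (poly_term ns i) \<subseteq> insert i (set ns)"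
  by (induction ns) auto

lemma free_vars_recip_vals: "free_vars (recip_vals_fm ns i k) \<subseteq> insert i (set ns)"
  using term_vars_poly_term[of ns k] by (auto simp: recip_vals_fm_def)

lemma free_vars_recip_diffs: "free_vars (recip_diffs_fm ns i k) \<subseteq> insert i (set ns)"
  using free_vars_recip_vals[of ns k "k + 2"] free_vars_recip_vals[of ns "k + 1" "k + 2"]
  unfolding recip_diffs_fm_def by auto

lemma free_vars_contracts: "free_vars (contracts_fm ns i k) \<subseteq> insert i (set ns)"
  using free_vars_recip_diffs[of ns k "k + 1"] free_vars_recip_diffs[of ns "k + 1" "k + 2"]
  unfolding contracts_fm_def by auto

lemma free_vars_separates: "free_vars (separates_fm ns i k) \<subseteq> insert i (set ns)"
  using free_vars_recip_diffs[of ns k "k + 3"] free_vars_recip_diffs[of ns "k + 1" "k + 3"]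
    free_vars_recip_diffs[of ns "k + 2" "k + 3"]
  unfolding separates_fm_def by auto

lemma free_vars_poly_ideal: "free_vars (poly_ideal_fm ns i k) \<subseteq> insert i (set ns)"
  using free_vars_contracts[of ns i k] free_vars_separates[of ns i k]
  unfolding poly_ideal_fm_def by auto

lemma free_vars_poly_ring: "free_vars (poly_ring_fm ns i k) \<subseteq> insert i (set ns)"
  using free_vars_poly_ideal[of ns k "k + 1"] unfolding poly_ring_fm_def by auto

lemma free_vars_conj: "free_vars (conj_fm \<phi>s) = (\<Union>\<phi>\<in>set \<phi>s. free_vars \<phi>)"
  by (induction \<phi>s) auto

lemma free_vars_exs: "free_vars (exs_fm ns \<phi>) = free_vars \<phi> - set ns"
  by (induction ns) auto

lemma free_vars_admissible: "free_vars (admissible_fm ns k) \<subseteq> set ns"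
proof -
  have "free_vars (conj_fm (map (\<lambda>n. poly_ring_fm ns n k) ns)) \<subseteq> set ns"
    using free_vars_poly_ring[of ns _ k] by (fastforce simp: free_vars_conj)
  then show ?thesis
    using free_vars_poly_ring[of ns k "k + 1"] free_vars_poly_ring[of ns "k + 1" "k + 2"]
      free_vars_poly_ring[of ns "k + 2" "k + 3"] free_vars_poly_ideal[of ns "k + 1" "k + 2"]
      term_vars_poly_term[of ns k]
    unfolding admissible_fm_def by auto
qed

section \<open>Meaning of the formulas\<close>

lemma term_val_poly_term: "term_val M e (poly_term ns i) = monic_val M (map e ns) (e i)"
  by (induction ns) auto

text \<open>Lets the simplifier see that assigning a bound variable leaves the coefficients
  \<open>map e ns\<close> unchanged.\<close>

lemma fresh: "\<lbrakk>set ns \<subseteq> {..<k}; k \<le> j\<rbrakk> \<Longrightarrow> j \<notin> set ns"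
  for ns :: "nat list"
  by auto

lemma sat_recip_vals:
  assumes "set ns \<subseteq> {..<k}" "i < k" "e i \<in> carrier M"
  shows "sat M e (recip_vals_fm ns i k) \<longleftrightarrow> e i \<in> recip_vals M (map e ns)"
  using assms fresh[of ns k]
  by (simp add: recip_vals_fm_def recip_vals_def term_val_poly_term)

lemma sat_recip_diffs:
  assumes "set ns \<subseteq> {..<k}" "i < k" "e i \<in> carrier M"
  shows "sat M e (recip_diffs_fm ns i k) \<longleftrightarrow> e i \<in> recip_diffs M (map e ns)"
proof -
  have "set ns \<subseteq> {..<k + 2}" using assms by auto
  then have "sat M e (recip_diffs_fm ns i k) \<longleftrightarrow> (\<exists>u\<in>carrier M. \<exists>w\<in>carrier M.
      u \<in> recip_vals M (map e ns) \<and> w \<in> recip_vals M (map e ns) \<and> e i = u \<oplus>\<^bsub>M\<^esub> \<ominus>\<^bsub>M\<^esub> w)"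
    using assms fresh[of ns k] by (simp add: recip_diffs_fm_def sat_recip_vals conj_assoc)
  then show ?thesis using assms by (auto simp: recip_diffs_def recip_vals_def)
qed

lemma recip_diffs_subset: "x \<in> recip_diffs M cs \<Longrightarrow> x \<in> carrier M"
  by (simp add: recip_diffs_def)

lemma sat_contracts:
  assumes "set ns \<subseteq> {..<k}" "i < k" "e i \<in> carrier M"
  shows "sat M e (contracts_fm ns i k) \<longleftrightarrow> contracts M (recip_diffs M (map e ns)) (e i)"
proof -
  have *: "set ns \<subseteq> {..<k + 1}" "set ns \<subseteq> {..<k + 2}" using assms by auto
  show ?thesis
    using assms fresh[of ns k] *
    by (auto simp: contracts_fm_def sat_recip_diffs contracts_def recip_diffs_subset)
qed

lemma sat_separates:
  assumes "set ns \<subseteq> {..<k}" "i < k" "e i \<in> carrier M"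
  shows "sat M e (separates_fm ns i k) \<longleftrightarrow> separates M (recip_diffs M (map e ns)) (e i)"
proof -
  have *: "set ns \<subseteq> {..<k + 3}" using assms by auto
  show ?thesis
    using assms fresh[of ns k] *
    by (auto simp: separates_fm_def sat_recip_diffs separates_def recip_diffs_subset)
qed

lemma sat_poly_ideal:
  assumes "set ns \<subseteq> {..<k}" "i < k" "e i \<in> carrier M"
  shows "sat M e (poly_ideal_fm ns i k) \<longleftrightarrow> e i \<in> poly_ideal M (map e ns)"
  using assms by (simp add: poly_ideal_fm_def poly_ideal_def sat_contracts sat_separates)

lemma poly_ideal_subset: "x \<in> poly_ideal M cs \<Longrightarrow> x \<in> carrier M"
  by (simp add: poly_ideal_def)

lemma sat_poly_ring:
  assumes "set ns \<subseteq> {..<k}" "i < k" "e i \<in> carrier M"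
  shows "sat M e (poly_ring_fm ns i k) \<longleftrightarrow> e i \<in> poly_ring_of M (map e ns)"
proof -
  have *: "set ns \<subseteq> {..<k + 1}" using assms by auto
  show ?thesis
    using assms fresh[of ns k] *
    by (auto simp: poly_ring_fm_def sat_poly_ideal poly_ring_of_def poly_ideal_subset)
qed

lemma sat_conj: "sat M e (conj_fm \<phi>s) \<longleftrightarrow> (\<forall>\<phi>\<in>set \<phi>s. sat M e \<phi>)"
  by (induction \<phi>s) auto

lemma sat_exs:
  "sat M e (exs_fm ns \<phi>) \<longleftrightarrow>
    (\<exists>e'. sat M e' \<phi> \<and> e' ` set ns \<subseteq> carrier M \<and> (\<forall>i. i \<notin> set ns \<longrightarrow> e' i = e i))"
proof (induction ns arbitrary: e)
  case Nil
  have "(\<forall>i. e' i = e i) \<longleftrightarrow> e' = e" for e' by auto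
  then show ?case by simp
next
  case (Cons n ns)
  show ?case
  proof
    assume "sat M e (exs_fm (n # ns) \<phi>)"
    then obtain a e' where *: "a \<in> carrier M" "sat M e' \<phi>" "e' ` set ns \<subseteq> carrier M"
      "\<And>i. i \<notin> set ns \<Longrightarrow> e' i = (e(n := a)) i" using Cons by auto
    \<comment> \<open>If \<open>n\<close> occurs again in \<open>ns\<close>, an inner quantifier has
      overwritten the value \<open>a\<close>.\<close>
    then have "e' n \<in> carrier M" by (cases "n \<in> set ns") auto
    then show "\<exists>e'. sat M e' \<phi> \<and> e' ` set (n # ns) \<subseteq> carrier M \<and>
        (\<forall>i. i \<notin> set (n # ns) \<longrightarrow> e' i = e i)"
      using * by (intro exI[of _ e']) auto
  next
    assume "\<exists>e'. sat M e' \<phi> \<and> e' ` set (n # ns) \<subseteq> carrier M \<and>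
        (\<forall>i. i \<notin> set (n # ns) \<longrightarrow> e' i = e i)"
    then obtain e' where *: "sat M e' \<phi>" "e' ` set (n # ns) \<subseteq> carrier M"
      "\<And>i. i \<notin> set (n # ns) \<Longrightarrow> e' i = e i" by auto
    have "sat M (e(n := e' n)) (exs_fm ns \<phi>)"
      unfolding Cons by (rule exI[of _ e']) (use * in auto)
    then show "sat M e (exs_fm (n # ns) \<phi>)" using * by auto
  qed
qed

lemma sat_admissible:
  assumes "set ns \<subseteq> {..<k}" "e ` set ns \<subseteq> carrier M" "ring_structure M"
  shows "sat M e (admissible_fm ns k) \<longleftrightarrow> admissible M (map e ns)"
proof -
  have *: "set ns \<subseteq> {..<k + 1}" "set ns \<subseteq> {..<k + 2}" "set ns \<subseteq> {..<k + 3}" using assms by auto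
  have c: "sat M e (conj_fm (map (\<lambda>n. poly_ring_fm ns n k) ns)) \<longleftrightarrow>
      set (map e ns) \<subseteq> poly_ring_of M (map e ns)"
  proof -
    have "sat M e (poly_ring_fm ns n k) \<longleftrightarrow> e n \<in> poly_ring_of M (map e ns)" if "n \<in> set ns" for n
      by (rule sat_poly_ring[OF assms(1)]) (use that assms in auto)
    then show ?thesis by (auto simp: sat_conj)
  qed
  have cl: "x \<oplus>\<^bsub>M\<^esub> y \<in> carrier M" "x \<otimes>\<^bsub>M\<^esub> y \<in> carrier M"
    if "x \<in> carrier M" "y \<in> carrier M" for x y
    using that assms(3) by (auto simp: ring_structure_def)
  have mv: "monic_val M cs x \<in> carrier M" if "set cs \<subseteq> carrier M" "x \<in> carrier M" for cs x
    using that assms(3) by (induction cs) (auto simp: ring_structure_def)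
  have sub: "x \<in> poly_ring_of M cs \<Longrightarrow> x \<in> carrier M" for x cs
    by (simp add: poly_ring_of_def)
  show ?thesis
    using assms(1) fresh[of ns k] * c mv[of "map e ns"] assms(2)
    by (auto simp: admissible_fm_def admissible_def sat_poly_ring sat_poly_ideal
        term_val_poly_term sub cl)
qed

text \<open>Variable 0 is the element x, variables 1 to d are the coefficients, variable d + 1 is
  the inverse of x, and the auxiliary formulas bind variables from d + 2 on.\<close>

definition valuation_ring_fm :: "nat \<Rightarrow> ring_formula" where
  "valuation_ring_fm d = FNot (FEx (d + 1) (FAnd (FEq (Mul (Var 0) (Var (d + 1))) One)
     (exs_fm [1..<d + 1] (FAnd (admissible_fm [1..<d + 1] (d + 2))
       (poly_ideal_fm [1..<d + 1] (d + 1) (d + 2))))))"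

lemma free_vars_valuation_ring: "free_vars (valuation_ring_fm d) \<subseteq> {0}"
  using free_vars_admissible[of "[1..<d + 1]" "d + 2"]
    free_vars_poly_ideal[of "[1..<d + 1]" "d + 1" "d + 2"]
  unfolding valuation_ring_fm_def by (auto simp: free_vars_exs)

lemma sat_valuation_ring:
  assumes M: "ring_structure M" and x: "x \<in> carrier M"
  shows "sat_tuple M (valuation_ring_fm d) [x] \<longleftrightarrow> \<not> (\<exists>y\<in>carrier M. x \<otimes>\<^bsub>M\<^esub> y = \<one>\<^bsub>M\<^esub> \<and>
    (\<exists>cs\<in>tuples M d. admissible M cs \<and> y \<in> poly_ideal M cs))"
proof -
  define ns where "ns = [1..<d + 1]"
  have ns: "set ns \<subseteq> {..<d + 2}" "length ns = d" "d + 1 \<notin> set ns" "0 \<notin> set ns"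
    by (auto simp: ns_def)
  have "sat M ((\<lambda>i. [x] ! i)(d + 1 := y)) (exs_fm ns (FAnd (admissible_fm ns (d + 2))
      (poly_ideal_fm ns (d + 1) (d + 2)))) \<longleftrightarrow>
      (\<exists>cs\<in>tuples M d. admissible M cs \<and> y \<in> poly_ideal M cs)" (is "?L \<longleftrightarrow> ?R")
    if y: "y \<in> carrier M" for y
  proof
    assume ?L
    then obtain e where e: "sat M e (admissible_fm ns (d + 2))"
        "sat M e (poly_ideal_fm ns (d + 1) (d + 2))" "e ` set ns \<subseteq> carrier M" "e (d + 1) = y"
      using ns by (auto simp: sat_exs)
    have "admissible M (map e ns)" using sat_admissible[OF ns(1) e(3) M] e(1) by simp
    moreover have "y \<in> poly_ideal M (map e ns)"
      using sat_poly_ideal[OF ns(1), of "d + 1" e M] e y by simp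
    moreover have "map e ns \<in> tuples M d" using e(3) ns by (simp add: tuples_def)
    ultimately show ?R by blast
  next
    assume ?R
    then obtain cs where cs: "cs \<in> tuples M d" "admissible M cs" "y \<in> poly_ideal M cs" by blast
    \<comment> \<open>Since variable 0 holds x, variable i holds the coefficient with index i - 1.
      Outside \<open>ns\<close> the old environment is kept, as \<open>sat_exs\<close>
      demands.\<close>
    define e where "e i = (if i = 0 then x else if i = d + 1 then y
      else if i \<in> set ns then cs ! (i - 1) else ((\<lambda>i. [x] ! i)(d + 1 := y)) i)" for i
    have map: "map e ns = cs"
    proof (rule nth_equalityI)
      show "length (map e ns) = length cs" using cs(1) ns by (simp add: tuples_def)
      fix i assume "i < length (map e ns)"
      then have i: "i < d" using ns by simp
      have "ns ! i = i + 1" using nth_upt[of 1 i "d + 1"] i by (simp add: ns_def del: upt_Suc)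
      moreover have "i + 1 \<in> set ns" using i by (auto simp: ns_def)
      ultimately show "map e ns ! i = cs ! i" using i ns by (simp add: e_def)
    qed
    then have im: "e ` set ns \<subseteq> carrier M" using cs(1) by (auto simp: tuples_def simp flip: set_map)
    have "sat M e (admissible_fm ns (d + 2))" using sat_admissible[OF ns(1) im M] cs map by simp
    moreover have "sat M e (poly_ideal_fm ns (d + 1) (d + 2))"
      using sat_poly_ideal[OF ns(1), of "d + 1" e M] cs y map by (simp add: e_def)
    ultimately show ?L unfolding sat_exs using im ns by (intro exI[of _ e]) (auto simp: e_def)
  qed
  then show ?thesis by (simp add: sat_tuple_def valuation_ring_fm_def ns_def)
qed

section \<open>Contractions yield the tree property\<close>

text \<open>
  The nodes of the tree correspond to the balls \<open>s + t\<^sup>n D\<close> with \<open>s\<close> a sum of powers of \<open>t\<close> with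
  exponents below \<open>n\<close>.
\<close>

fun node_exp :: "nat list \<Rightarrow> nat" where
  "node_exp [] = 0"
| "node_exp (i # is) = 2 * i + 2 + node_exp is"

text \<open>Each entry i raises the exponent by 2 i + 2. Exponents of siblings thus differ by at
  least 2, and each increment is at least 2, so that after splitting off one factor t another
  remains to form t + t w, which \<open>contracts\<close> keeps in D.\<close>

fun node_center :: "('a, 'b) ring_scheme \<Rightarrow> 'a \<Rightarrow> nat list \<Rightarrow> 'a" where
  "node_center R t [] = \<zero>\<^bsub>R\<^esub>"
| "node_center R t (i # is) = t [^]\<^bsub>R\<^esub> (2 * i + 2) \<otimes>\<^bsub>R\<^esub> (\<one>\<^bsub>R\<^esub> \<oplus>\<^bsub>R\<^esub> node_center R t is)"

text \<open>Variable 0 is the point, variables 1 to d are the coefficients, d + 1 and d + 2 are the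
  center and the scaling factor. As the latter are parameters, a single formula serves for all
  nodes.\<close>

definition ball_fm :: "nat \<Rightarrow> ring_formula" where
  "ball_fm d = FEx (d + 3) (FAnd (recip_diffs_fm [1..<d + 1] (d + 3) (d + 4))
     (FEq (Var 0) (Add (Var (d + 1)) (Mul (Var (d + 2)) (Var (d + 3))))))"

lemma free_vars_ball: "free_vars (ball_fm d) \<subseteq> {..<1 + (d + 2)}"
  using free_vars_recip_diffs[of "[1..<d + 1]" "d + 3" "d + 4"] unfolding ball_fm_def by auto

lemma sat_ball:
  assumes "length cs = d"
  shows "sat_tuple M (ball_fm d) ([y] @ cs @ [a, b]) \<longleftrightarrow>
    (\<exists>z\<in>recip_diffs M cs. y = a \<oplus>\<^bsub>M\<^esub> b \<otimes>\<^bsub>M\<^esub> z)"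
proof -
  define ns where "ns = [1..<d + 1]"
  have ns: "set ns \<subseteq> {..<d + 4}" "d + 3 \<notin> set ns" by (auto simp: ns_def)
  define e where "e = (\<lambda>i. ([y] @ cs @ [a, b]) ! i)"
  have map: "map e ns = cs"
  proof (rule nth_equalityI)
    show "length (map e ns) = length cs" using assms by (simp add: ns_def)
    fix i assume "i < length (map e ns)"
    then have i: "i < d" by (simp add: ns_def del: upt_Suc)
    have "ns ! i = i + 1" using nth_upt[of 1 i "d + 1"] i by (simp add: ns_def del: upt_Suc)
    then show "map e ns ! i = cs ! i"
      using i assms \<open>i < length (map e ns)\<close> by (simp add: e_def nth_append)
  qed
  have "e 0 = y" "e (d + 1) = a" "e (d + 2) = b"
    using assms by (auto simp: e_def nth_append)
  moreover have "sat M (e(d + 3 := z)) (recip_diffs_fm ns (d + 3) (d + 4)) \<longleftrightarrow> z \<in> recip_diffs M cs"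
    if "z \<in> carrier M" for z
    using sat_recip_diffs[OF ns(1), of "d + 3" "e(d + 3 := z)" M] that ns(2) map by simp
  ultimately show ?thesis
    unfolding sat_tuple_def e_def[symmetric] ball_fm_def ns_def[symmetric]
    by (auto simp: recip_diffs_subset)
qed

section \<open>The tree of balls of a contraction\<close>

locale contraction = field R for R (structure) +
  fixes D t
  assumes D_carrier: "D \<subseteq> carrier R" and zero_D: "\<zero> \<in> D" and t_carrier: "t \<in> carrier R"
    and contracts: "contracts R D t" and weakly_separates: "weakly_separates R D t"
begin

lemma t_nonzero: "t \<noteq> \<zero>"
  and t_D: "x \<in> D \<Longrightarrow> t \<otimes> x \<in> D"
  and t_D': "x \<in> D \<Longrightarrow> t \<oplus> t \<otimes> x \<in> D"
  using contracts by (auto simp: contracts_def)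

lemma pow_D: "x \<in> D \<Longrightarrow> t [^] (n::nat) \<otimes> x \<in> D"
proof (induction n)
  case 0
  then show ?case using D_carrier by auto
next
  case (Suc n)
  have "t [^] Suc n \<otimes> x = t \<otimes> (t [^] n \<otimes> x)"
    using Suc.prems D_carrier t_carrier by (auto simp: m_ac subset_iff)
  then show ?case using t_D[OF Suc.IH[OF Suc.prems]] by simp
qed

lemma node_center_closed: "node_center R t is \<in> carrier R"
  by (induction "is") (auto simp: t_carrier)

lemma node_center_append:
  "node_center R t (is @ js) = node_center R t is \<oplus> t [^] node_exp is \<otimes> node_center R t js"
proof (induction "is")
  case (Cons i "is")
  have "node_center R t ((i # is) @ js) = t [^] (2 * i + 2) \<otimes> (\<one> \<oplus> node_center R t is) \<oplus>
      (t [^] (2 * i + 2) \<otimes> t [^] node_exp is) \<otimes> node_center R t js"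
    using Cons t_carrier node_center_closed by (simp add: r_distr a_assoc m_assoc)
  moreover have "t [^] (2 * i + 2) \<otimes> t [^] node_exp is = t [^] node_exp (i # is)"
    using nat_pow_mult[OF t_carrier, of "2 * i + 2" "node_exp is"] by (simp only: node_exp.simps)
  ultimately show ?case by (simp only: node_center.simps)
qed (simp add: node_center_closed)

text \<open>By induction, t^(2 i + 2) (1 + t w) is t times t^(2 i) (t + t (t w)), and the latter
  factor lies in \<open>D\<close>. Together with \<open>node_center_append\<close> this puts the
  center of a node into the balls of all its ancestors.\<close>

lemma node_center_D: "\<exists>w\<in>D. node_center R t is = t \<otimes> w"
proof (induction "is")
  case Nil
  then show ?case using zero_D t_carrier by (intro bexI[of _ \<zero>]) auto
next
  case (Cons i "is")
  then obtain w where w: "w \<in> D" "node_center R t is = t \<otimes> w" by blast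
  have wc: "w \<in> carrier R" using w D_carrier by blast
  have "t [^] (2 * i + 2) = t \<otimes> (t [^] (2 * i) \<otimes> t)"
    using t_carrier by (simp add: m_ac)
  then have "node_center R t (i # is) = t \<otimes> (t [^] (2 * i) \<otimes> (t \<oplus> t \<otimes> (t \<otimes> w)))"
    using w wc t_carrier by (simp add: r_distr m_ac)
  then show ?case using pow_D[OF t_D'[OF t_D[OF w(1)]]] by blast
qed

lemma pow_nonzero: "t [^] (n::nat) \<noteq> \<zero>"
  using t_carrier t_nonzero integral by (induction n) auto

text \<open>Cancelling t^(2 i + 2) turns the left side into 1 + t x and the right side into t times
  an element of \<open>D\<close>, which \<open>weakly_separates\<close> forbids.\<close>

lemma siblings_disjoint:
  fixes i j :: nat
  assumes ij: "i < j" and x: "x \<in> D" and z: "z \<in> D"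
  shows "t [^] (2 * i + 2) \<oplus> t [^] (2 * i + 3) \<otimes> x \<noteq> t [^] (2 * j + 2) \<oplus> t [^] (2 * j + 3) \<otimes> z"
proof
  assume eq: "t [^] (2 * i + 2) \<oplus> t [^] (2 * i + 3) \<otimes> x = t [^] (2 * j + 2) \<oplus> t [^] (2 * j + 3) \<otimes> z"
  have c: "x \<in> carrier R" "z \<in> carrier R" using x z D_carrier by auto
  define r where "r = j - i - 1"
  define p where "p = t [^] (2 * i + 2)"
  define s where "s = t [^] (2 * r)"
  have p: "p \<in> carrier R" "p \<noteq> \<zero>" and s: "s \<in> carrier R"
    using t_carrier pow_nonzero unfolding p_def s_def by blast+
  have e1: "t [^] (2 * i + 3) = p \<otimes> t"
    using t_carrier nat_pow_Suc[of t "2 * i + 2"] by (simp add: p_def numeral_eq_Suc)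
  have "2 * j + 2 = (2 * i + 2) + (2 * r + 2)" using ij by (simp add: r_def)
  then have "t [^] (2 * j + 2) = p \<otimes> t [^] (2 * r + 2)"
    using t_carrier by (simp only: p_def nat_pow_mult)
  then have e2: "t [^] (2 * j + 2) = p \<otimes> (s \<otimes> t \<otimes> t)"
    by (simp add: s_def)
  have e3: "t [^] (2 * j + 3) = p \<otimes> (s \<otimes> t \<otimes> t) \<otimes> t"
    using nat_pow_Suc[of t "2 * j + 2"] e2 by (simp add: numeral_eq_Suc)
  have "p \<otimes> (\<one> \<oplus> t \<otimes> x) = p \<otimes> (t \<otimes> (s \<otimes> (t \<oplus> t \<otimes> (t \<otimes> z))))"
    using eq unfolding e1 e2 e3 p_def[symmetric] using p s c t_carrier
    by (simp add: r_distr m_ac)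
  then have "\<one> \<oplus> t \<otimes> x = t \<otimes> (s \<otimes> (t \<oplus> t \<otimes> (t \<otimes> z)))"
    using p s c t_carrier by (subst (asm) m_lcancel) auto
  moreover have "s \<otimes> (t \<oplus> t \<otimes> (t \<otimes> z)) \<in> D"
    unfolding s_def by (rule pow_D[OF t_D'[OF t_D[OF z]]])
  ultimately show False using weakly_separates x unfolding weakly_separates_def by blast
qed

text \<open>The common prefix acts as y \<mapsto> a + p y with nonzero p, an injective map, which
  reduces the claim to \<open>siblings_disjoint\<close>.\<close>

lemma nodes_disjoint:
  assumes ij: "i < j" and x: "x \<in> D" and z: "z \<in> D"
  shows "node_center R t (is @ [i]) \<oplus> t [^] Suc (node_exp (is @ [i])) \<otimes> x \<noteq>
    node_center R t (is @ [j]) \<oplus> t [^] Suc (node_exp (is @ [j])) \<otimes> z"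
proof -
  define a where "a = node_center R t is"
  define p where "p = t [^] node_exp is"
  have c: "x \<in> carrier R" "z \<in> carrier R" "a \<in> carrier R" "p \<in> carrier R" "p \<noteq> \<zero>"
    using x z D_carrier t_carrier pow_nonzero node_center_closed unfolding p_def a_def by auto
  have ne: "node_exp (is @ [l]) = node_exp is + (2 * l + 2)" for l
    by (induction "is") auto
  have *: "node_center R t (is @ [l]) \<oplus> t [^] Suc (node_exp (is @ [l])) \<otimes> y =
      a \<oplus> p \<otimes> (t [^] (2 * l + 2) \<oplus> t [^] (2 * l + 3) \<otimes> y)" if y: "y \<in> carrier R" for l y
  proof -
    have "Suc (node_exp (is @ [l])) = node_exp is + (2 * l + 3)" by (simp add: ne)
    then have "t [^] Suc (node_exp (is @ [l])) = p \<otimes> t [^] (2 * l + 3)"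
      using t_carrier by (simp only: p_def nat_pow_mult)
    moreover have "node_center R t (is @ [l]) = a \<oplus> p \<otimes> t [^] (2 * l + 2)"
      unfolding node_center_append a_def p_def using t_carrier by (simp del: nat_pow_Suc)
    ultimately show ?thesis using c y t_carrier by (simp only: r_distr m_assoc a_assoc nat_pow_closed m_closed)
  qed
  have "t [^] (2 * i + 2) \<oplus> t [^] (2 * i + 3) \<otimes> x \<in> carrier R"
    "t [^] (2 * j + 2) \<oplus> t [^] (2 * j + 3) \<otimes> z \<in> carrier R"
    using c t_carrier by (simp_all del: nat_pow_Suc)
  then show ?thesis
    unfolding *[OF c(1)] *[OF c(2)] using siblings_disjoint[OF assms] c(3-5)
    by (simp add: m_lcancel del: nat_pow_Suc)
qed

end

lemma (in field) contraction_tree_property: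
  assumes cs: "cs \<in> tuples R d" and t: "t \<in> carrier R"
    and ct: "contracts R (recip_diffs R cs) t" "weakly_separates R (recip_diffs R cs) t"
  shows "tree_property_in R (ball_fm d) 1 (d + 2) 2"
proof -
  have len: "length cs = d" "set cs \<subseteq> carrier R" using cs by (auto simp: tuples_def)
  interpret contraction R "recip_diffs R cs" t
    using recip_diffs_carrier zero_recip_diffs[OF len(2)] t ct by unfold_locales
  \<comment> \<open>The scaling factor has one power of t more than \<open>node_exp\<close>: the
    factor t that \<open>node_center_D\<close> splits off the contribution of the
    descendants.\<close>
  define c where "c \<eta> = cs @ [node_center R t \<eta>, t [^] Suc (node_exp \<eta>)]" for \<eta>
  have sat: "sat_tuple R (ball_fm d) ([y] @ c \<eta>) \<longleftrightarrow>
      (\<exists>z\<in>recip_diffs R cs. y = node_center R t \<eta> \<oplus> t [^] Suc (node_exp \<eta>) \<otimes> z)" for y \<eta>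
    unfolding c_def by (rule sat_ball[OF len(1)])
  show ?thesis
    unfolding tree_property_in_def
  proof (intro exI[of _ c] conjI allI impI)
    show "range c \<subseteq> tuples R (d + 2)"
      using len t node_center_closed by (auto simp: tuples_def c_def)
  next
    fix \<eta> :: "nat list" and I :: "nat set"
    assume "finite I \<and> card I = 2"
    then obtain i j where ij: "i \<in> I" "j \<in> I" "i < j"
      by (auto simp: card_2_iff) (metis insertI1 insert_commute linorder_neqE_nat)
    show "\<not> (\<exists>b\<in>tuples R 1. \<forall>i\<in>I. sat_tuple R (ball_fm d) (b @ c (\<eta> @ [i])))"
    proof
      assume "\<exists>b\<in>tuples R 1. \<forall>i\<in>I. sat_tuple R (ball_fm d) (b @ c (\<eta> @ [i]))"
      then obtain b where b: "b \<in> tuples R 1" "\<forall>i\<in>I. sat_tuple R (ball_fm d) (b @ c (\<eta> @ [i]))" by blast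
      then obtain y where y: "b = [y]" by (auto simp: tuples_def length_Suc_conv)
      show False using b(2) ij nodes_disjoint[OF ij(3)] unfolding y sat by metis
    qed
  next
    fix \<sigma> :: "nat \<Rightarrow> nat" and n :: nat
    \<comment> \<open>The center of the last node realizes the formulas of the whole path.\<close>
    define y where "y = node_center R t (map \<sigma> [0..<n])"
    have "sat_tuple R (ball_fm d) ([y] @ c (map \<sigma> [0..<l]))" if l: "l \<in> {1..n}" for l
    proof -
      have "[0..<n] = [0..<l] @ [l..<n]" using l upt_add_eq_append[of 0 l "n - l"] by auto
      then have "map \<sigma> [0..<n] = map \<sigma> [0..<l] @ map \<sigma> [l..<n]" by simp
      then have y: "y = node_center R t (map \<sigma> [0..<l]) \<oplus>
          t [^] node_exp (map \<sigma> [0..<l]) \<otimes> node_center R t (map \<sigma> [l..<n])"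
        unfolding y_def by (simp only: node_center_append)
      obtain w where w: "w \<in> recip_diffs R cs" "node_center R t (map \<sigma> [l..<n]) = t \<otimes> w"
        using node_center_D by blast
      then have "t [^] node_exp (map \<sigma> [0..<l]) \<otimes> node_center R t (map \<sigma> [l..<n]) =
          t [^] Suc (node_exp (map \<sigma> [0..<l])) \<otimes> w"
        using t D_carrier by (auto simp: m_assoc subset_iff)
      then show ?thesis unfolding sat using w(1) y by metis
    qed
    then show "\<exists>b\<in>tuples R 1. \<forall>l\<in>{1..n}. sat_tuple R (ball_fm d) (b @ c (map \<sigma> [0..<l]))"
      using node_center_closed by (intro bexI[of _ "[y]"]) (auto simp: tuples_def y_def)
  qed
qed

lemma (in field) simple_no_contraction:
  assumes "simple_theory (Th R)" "cs \<in> tuples R d" "t \<in> carrier R"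
    "contracts R (recip_diffs R cs) t"
  shows "\<not> weakly_separates R (recip_diffs R cs) t"
  using contraction_tree_property[OF assms(2-4)] simple_not_tree_property[OF assms(1) free_vars_ball]
  by auto

section \<open>Derivatives and translations\<close>

text \<open>Here the coefficients, including the leading one, are listed in increasing degree.\<close>

primrec list_val :: "('a, 'b) ring_scheme \<Rightarrow> 'a list \<Rightarrow> 'a \<Rightarrow> 'a" where
  "list_val R [] x = \<zero>\<^bsub>R\<^esub>"
| "list_val R (c # cs) x = c \<oplus>\<^bsub>R\<^esub> x \<otimes>\<^bsub>R\<^esub> list_val R cs x"

text \<open>The product rule for the Horner form c + X g.\<close>

primrec list_deriv :: "('a, 'b) ring_scheme \<Rightarrow> 'a list \<Rightarrow> 'a \<Rightarrow> 'a" where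
  "list_deriv R [] x = \<zero>\<^bsub>R\<^esub>"
| "list_deriv R (c # cs) x = list_val R cs x \<oplus>\<^bsub>R\<^esub> x \<otimes>\<^bsub>R\<^esub> list_deriv R cs x"

text \<open>Multiplies the monic polynomial with coefficients \<open>es\<close> by \<open>X \<oplus> a\<close> and adds \<open>u\<close>.\<close>

primrec mult_linear :: "('a, 'b) ring_scheme \<Rightarrow> 'a \<Rightarrow> 'a \<Rightarrow> 'a list \<Rightarrow> 'a list" where
  "mult_linear R a u [] = [u \<oplus>\<^bsub>R\<^esub> a]"
| "mult_linear R a u (e # es) = (u \<oplus>\<^bsub>R\<^esub> a \<otimes>\<^bsub>R\<^esub> e) # mult_linear R a e es"

text \<open>The coefficients of f (X + a), computed from the Horner form of f.\<close>

primrec translate :: "('a, 'b) ring_scheme \<Rightarrow> 'a \<Rightarrow> 'a list \<Rightarrow> 'a list" where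
  "translate R a [] = []"
| "translate R a (c # cs) = mult_linear R a c (translate R a cs)"

context cring
begin

lemma list_val_closed:
  "\<lbrakk>set cs \<subseteq> carrier R; x \<in> carrier R\<rbrakk> \<Longrightarrow> list_val R cs x \<in> carrier R"
  by (induction cs) auto

lemma list_deriv_closed:
  "\<lbrakk>set cs \<subseteq> carrier R; x \<in> carrier R\<rbrakk> \<Longrightarrow> list_deriv R cs x \<in> carrier R"
  by (induction cs) (auto simp: list_val_closed)

lemma eval_eq_list_val:
  "\<lbrakk>set p \<subseteq> carrier R; x \<in> carrier R\<rbrakk> \<Longrightarrow> eval p x = list_val R (rev p) x"
proof (induction p rule: rev_induct)
  case (snoc c p)
  then show ?case
    using eval_append_aux[of p c x] list_val_closed[of "rev p" x] by (simp add: a_comm m_comm)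
qed simp

lemma list_val_snoc:
  "\<lbrakk>set cs \<subseteq> carrier R; x \<in> carrier R\<rbrakk> \<Longrightarrow> list_val R (cs @ [\<one>]) x = monic_val R cs x"
  by (induction cs) auto

lemma list_val_smult:
  "\<lbrakk>set cs \<subseteq> carrier R; x \<in> carrier R; a \<in> carrier R\<rbrakk> \<Longrightarrow>
    list_val R (map (\<lambda>c. a \<otimes> c) cs) x = a \<otimes> list_val R cs x"
  by (induction cs) (auto simp: r_distr m_lcomm list_val_closed)

lemma list_deriv_smult:
  "\<lbrakk>set cs \<subseteq> carrier R; x \<in> carrier R; a \<in> carrier R\<rbrakk> \<Longrightarrow>
    list_deriv R (map (\<lambda>c. a \<otimes> c) cs) x = a \<otimes> list_deriv R cs x"
  by (induction cs) (auto simp: r_distr m_lcomm list_val_closed list_deriv_closed list_val_smult)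

text \<open>The offset \<open>k\<close> generalizes the claim for the induction, which passes to k +
  1 on the tail.\<close>

lemma list_val_index_mult:
  "\<lbrakk>set cs \<subseteq> carrier R; x \<in> carrier R\<rbrakk> \<Longrightarrow>
    list_val R (map (\<lambda>i. add_pow R (i + k) (cs ! i)) [0..<length cs]) x =
      add_pow R k (list_val R cs x) \<oplus> x \<otimes> list_deriv R cs x"
proof (induction cs arbitrary: k)
  case (Cons c cs)
  have cl: "c \<in> carrier R" "x \<in> carrier R" "list_val R cs x \<in> carrier R" "list_deriv R cs x \<in> carrier R"
    using Cons.prems list_val_closed list_deriv_closed by auto
  have "map (\<lambda>i. add_pow R (i + k) ((c # cs) ! i)) [0..<length (c # cs)] =
      (add_pow R k c) # map (\<lambda>i. add_pow R (i + Suc k) (cs ! i)) [0..<length cs]"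
    by (simp add: map_upt_Suc del: upt_Suc)
  then have "list_val R (map (\<lambda>i. add_pow R (i + k) ((c # cs) ! i)) [0..<length (c # cs)]) x =
      add_pow R k c \<oplus> x \<otimes> (add_pow R (Suc k) (list_val R cs x) \<oplus> x \<otimes> list_deriv R cs x)"
    using Cons.IH[of "Suc k"] Cons.prems by (simp del: upt_Suc add.nat_pow_Suc)
  also have "\<dots> = (add_pow R k c \<oplus> add_pow R k (x \<otimes> list_val R cs x)) \<oplus>
      x \<otimes> (list_val R cs x \<oplus> x \<otimes> list_deriv R cs x)"
    using cl by (simp add: r_distr add_pow_rdistr a_ac)
  also have "\<dots> = add_pow R k (list_val R (c # cs) x) \<oplus> x \<otimes> list_deriv R (c # cs) x"
    using cl by (simp add: add.nat_pow_distrib)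
  finally show ?case .
qed simp

text \<open>If the polynomial is c + X g, its derivative has the coefficients (i + 1) g_i, so
  \<open>list_val_index_mult\<close> with k = 1 gives g(x) + x g'(x).\<close>

lemma eval_formal_deriv:
  assumes p: "set p \<subseteq> carrier R" and x: "x \<in> carrier R"
  shows "eval (formal_deriv R p) x = list_deriv R (rev p) x"
proof -
  define l where "l = map (\<lambda>i. add_pow R i (coeff p i)) [1..<length p]"
  have lc: "set l \<subseteq> carrier R" using p by (auto simp: l_def)
  have "eval (formal_deriv R p) x = eval (rev l) x"
    unfolding formal_deriv_def l_def rev_map[symmetric]
    by (rule eval_normalize) (use p x in auto)
  also have "\<dots> = list_val R l x" using eval_eq_list_val[of "rev l" x] lc x by simp
  also have "\<dots> = list_deriv R (rev p) x"
  proof (cases "rev p")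
    case (Cons c cs)
    have len: "length p = Suc (length cs)" using Cons by (metis length_Cons length_rev)
    have cl: "set cs \<subseteq> carrier R" using p Cons by (metis insert_subset list.simps(15) set_rev)
    have "coeff p (Suc i) = cs ! i" if "i < length cs" for i
    proof -
      have "coeff p (Suc i) = rev p ! Suc i"
        using coeff_nth[of "Suc i" p] that len by (simp add: rev_nth)
      then show ?thesis using Cons by simp
    qed
    then have "l = map (\<lambda>i. add_pow R (i + 1) (cs ! i)) [0..<length cs]"
      unfolding l_def len by (intro nth_equalityI) (auto simp del: upt_Suc add.nat_pow_Suc)
    then have "list_val R l x = add_pow R (1::nat) (list_val R cs x) \<oplus> x \<otimes> list_deriv R cs x"
      using list_val_index_mult[OF cl x, of 1] by simp
    then show ?thesis using Cons list_val_closed[OF cl x] by simp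
  qed (simp add: l_def)
  finally show ?thesis .
qed

lemma mult_linear_closed:
  "\<lbrakk>a \<in> carrier R; u \<in> carrier R; set es \<subseteq> carrier R\<rbrakk> \<Longrightarrow> set (mult_linear R a u es) \<subseteq> carrier R"
  by (induction es arbitrary: u) auto

lemma translate_closed:
  "\<lbrakk>a \<in> carrier R; set cs \<subseteq> carrier R\<rbrakk> \<Longrightarrow> set (translate R a cs) \<subseteq> carrier R"
  by (induction cs) (simp_all add: mult_linear_closed)

lemma length_mult_linear: "length (mult_linear R a u es) = Suc (length es)"
  by (induction es arbitrary: u) auto

lemma length_translate: "length (translate R a cs) = length cs"
  by (induction cs) (auto simp: length_mult_linear)

lemma monic_val_mult_linear:
  "\<lbrakk>a \<in> carrier R; u \<in> carrier R; set es \<subseteq> carrier R; x \<in> carrier R\<rbrakk> \<Longrightarrow>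
    monic_val R (mult_linear R a u es) x = u \<oplus> (x \<oplus> a) \<otimes> monic_val R es x"
proof (induction es arbitrary: u)
  case Nil
  then show ?case by (simp add: a_ac)
next
  case (Cons e es)
  have cl: "e \<in> carrier R" "monic_val R es x \<in> carrier R" using Cons.prems monic_val_closed by auto
  have "monic_val R (mult_linear R a u (e # es)) x =
      (u \<oplus> a \<otimes> e) \<oplus> x \<otimes> (e \<oplus> (x \<oplus> a) \<otimes> monic_val R es x)"
    using Cons by simp
  also have "\<dots> = u \<oplus> (x \<oplus> a) \<otimes> (e \<oplus> x \<otimes> monic_val R es x)"
    using cl Cons.prems by algebra
  finally show ?case by simp
qed

lemma monic_val_translate:
  "\<lbrakk>a \<in> carrier R; set cs \<subseteq> carrier R; x \<in> carrier R\<rbrakk> \<Longrightarrow>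
    monic_val R (translate R a cs) x = monic_val R cs (x \<oplus> a)"
  by (induction cs) (auto simp: monic_val_mult_linear translate_closed)

text \<open>Unlike \<open>cs ! 1\<close>, this takes the omitted leading coefficient into account:
  the value is 1 for a list of length 1 and 0 for the empty list. So statements about it can be
  proved by induction from the empty list.\<close>

definition linear_coeff :: "'a list \<Rightarrow> 'a" where
  "linear_coeff cs = (case cs of [] \<Rightarrow> \<zero> | c # ds \<Rightarrow> monic_val R ds \<zero>)"

lemma monic_val_zero:
  "\<lbrakk>set cs \<subseteq> carrier R; cs \<noteq> []\<rbrakk> \<Longrightarrow> monic_val R cs \<zero> = cs ! 0"
  using monic_val_closed[of _ \<zero>] by (cases cs) auto

lemma linear_coeff_nth:
  "\<lbrakk>set cs \<subseteq> carrier R; 2 \<le> length cs\<rbrakk> \<Longrightarrow> linear_coeff cs = cs ! 1"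
  using monic_val_zero[of "tl cs"] by (cases cs; cases "tl cs") (auto simp: linear_coeff_def)

lemma linear_coeff_mult_linear:
  assumes "a \<in> carrier R" "set es \<subseteq> carrier R" "u \<in> carrier R"
  shows "linear_coeff (mult_linear R a u es) = monic_val R es \<zero> \<oplus> a \<otimes> linear_coeff es"
proof (cases es)
  case (Cons e es')
  have cl: "e \<in> carrier R" "monic_val R es' \<zero> \<in> carrier R" "set es' \<subseteq> carrier R"
    using assms Cons monic_val_closed by auto
  then show ?thesis using assms Cons monic_val_mult_linear[of a e es' \<zero>]
    by (simp add: linear_coeff_def)
qed (use assms in \<open>simp add: linear_coeff_def\<close>)

text \<open>The start of the Taylor expansion: the linear coefficient of f (X + a) is f'(a). So
  translating to a point where the derivative does not vanish makes the linear coefficient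
  nonzero.\<close>

lemma linear_coeff_translate:
  "\<lbrakk>a \<in> carrier R; set cs \<subseteq> carrier R\<rbrakk> \<Longrightarrow>
    linear_coeff (translate R a cs) = list_deriv R (cs @ [\<one>]) a"
proof (induction cs)
  case (Cons c cs)
  then show ?case
    by (simp add: linear_coeff_mult_linear translate_closed monic_val_translate list_val_snoc)
qed (simp add: linear_coeff_def)

lemma list_deriv_snoc_zero:
  assumes "set cs \<subseteq> carrier R" "2 \<le> length cs"
  shows "list_deriv R (cs @ [\<one>]) \<zero> = cs ! 1"
proof -
  obtain c ds where cs: "cs = c # ds" "ds \<noteq> []" using assms(2) by (cases cs) fastforce+
  have "list_deriv R (ds @ [\<one>]) \<zero> \<in> carrier R" using assms(1) cs by (intro list_deriv_closed) auto
  moreover have "ds ! 0 \<in> carrier R" using assms(1) cs by (cases ds) auto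
  ultimately show ?thesis using assms cs monic_val_zero[of ds] by (simp add: list_val_snoc)
qed

end

section \<open>Polynomials without roots\<close>

lemma (in cring) monic_val_replicate_zero:
  "x \<in> carrier R \<Longrightarrow> monic_val R (replicate n \<zero>) x = x [^] n"
  by (induction n) (auto simp: m_comm)

text \<open>With q elements, X^q - X - 1 takes only the value -1. Finite fields are treated apart
  because the other case needs infinitely many points to find one where a nonzero derivative does
  not vanish.\<close>

lemma (in field) finite_field_rootless:
  assumes fin: "finite (carrier R)"
  shows "\<exists>d cs. 2 \<le> d \<and> cs \<in> tuples R d \<and> cs ! 1 \<noteq> \<zero> \<and> (\<forall>x\<in>carrier R. monic_val R cs x \<noteq> \<zero>)"
proof -
  define q where "q = card (carrier R)"
  have "card {\<zero>, \<one>} \<le> q" unfolding q_def by (rule card_mono[OF fin]) auto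
  then have q: "2 \<le> q" using one_not_zero by simp
  have pow: "x [^] q = x" if x: "x \<in> carrier R" for x
  proof (cases "x = \<zero>")
    case True
    then show ?thesis using q nat_pow_zero[of q] by simp
  next
    case False
    interpret G: group "Multiplicative_Group.mult_of R" by (rule field_mult_group)
    have "x [^]\<^bsub>Multiplicative_Group.mult_of R\<^esub> order (Multiplicative_Group.mult_of R) = \<one>\<^bsub>Multiplicative_Group.mult_of R\<^esub>"
      by (rule G.pow_order_eq_1) (use x False in simp)
    then have "x [^] (q - 1) = \<one>"
      using order_mult_of[OF fin] by (simp add: Multiplicative_Group.nat_pow_mult_of q_def order_def)
    moreover have "x [^] q = x [^] (q - 1) \<otimes> x" using q nat_pow_Suc[of x "q - 1"] by simp
    ultimately show ?thesis using x by simp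
  qed
  define cs where "cs = [\<ominus> \<one>, \<ominus> \<one>] @ replicate (q - 2) \<zero>"
  have "cs \<in> tuples R q" using q by (auto simp: cs_def tuples_def)
  moreover have "cs ! 1 \<noteq> \<zero>" using one_not_zero by (simp add: cs_def)
  moreover have "monic_val R cs x \<noteq> \<zero>" if x: "x \<in> carrier R" for x
  proof -
    have "x \<otimes> (x \<otimes> x [^] (q - 2)) = x [^] Suc (Suc (q - 2))" using x by (simp add: m_ac)
    also have "Suc (Suc (q - 2)) = q" using q by simp
    finally have "x \<otimes> (x \<otimes> x [^] (q - 2)) = x" using pow[OF x] by simp
    moreover have "monic_val R cs x = \<ominus> \<one> \<oplus> (x \<otimes> (x \<otimes> x [^] (q - 2)) \<ominus> x)"
      using x by (simp add: cs_def monic_val_replicate_zero a_minus_def r_distr r_minus a_comm)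
    ultimately have "monic_val R cs x = \<ominus> \<one>" using x by (simp add: a_minus_def r_neg)
    then show ?thesis using one_not_zero by simp
  qed
  ultimately show ?thesis using q by blast
qed

text \<open>If the derivative were zero, p would be a common divisor of itself and its derivative,
  hence a unit, that is, constant.\<close>

lemma (in field) separable_formal_deriv_nonzero:
  assumes p: "p \<in> carrier (poly_ring R)" "0 < degree p" "separable_poly R p"
  shows "formal_deriv R p \<noteq> []"
proof
  assume "formal_deriv R p = []"
  then have "p pdivides formal_deriv R p" using pdivides_zero[OF carrier_is_subring p(1)] by simp
  moreover have "p pdivides p"
    unfolding pdivides_def factor_def
    using p(1) ring.ring_simprules(12)[OF univ_poly_is_ring[OF carrier_is_subring], of p]
    by (metis carrier_is_subring dividesI monoid.r_one ring.is_monoid ring.ring_simprules(6) univ_poly_is_ring)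
  ultimately have "p \<in> Units (poly_ring R)" using p unfolding separable_poly_def by blast
  then show False using univ_poly_units'[OF carrier_is_subfield, of p] p(2) by simp
qed

text \<open>The nonzero derivative has finitely many zeros. After division by the leading
  coefficient, the polynomial is translated to a point \<open>a\<close> that is not one of
  them.\<close>

lemma (in field) infinite_field_rootless:
  assumes inf: "infinite (carrier R)" and p: "p \<in> carrier (poly_ring R)" "0 < degree p" "separable_poly R p"
    and nr: "\<And>x. x \<in> carrier R \<Longrightarrow> eval p x \<noteq> \<zero>"
  shows "\<exists>d cs. 2 \<le> d \<and> cs \<in> tuples R d \<and> cs ! 1 \<noteq> \<zero> \<and> (\<forall>x\<in>carrier R. monic_val R cs x \<noteq> \<zero>)"
proof -
  have pc: "set p \<subseteq> carrier R" using p(1) polynomial_incl univ_poly_carrier by blast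
  define q where "q = formal_deriv R p"
  have "set (map (\<lambda>i. add_pow R i (coeff p i)) (rev [1..<length p])) \<subseteq> carrier R" using pc by auto
  then have qP: "q \<in> carrier (poly_ring R)"
    unfolding q_def formal_deriv_def using normalize_gives_polynomial univ_poly_carrier by blast
  have "q \<noteq> []" unfolding q_def by (rule separable_formal_deriv_nonzero[OF p])
  have "\<exists>a\<in>carrier R. eval q a \<noteq> \<zero>"
  proof (rule ccontr)
    assume "\<not> ?thesis"
    then have "carrier R \<subseteq> {x. is_root q x}" using \<open>q \<noteq> []\<close> by (auto simp: is_root_def)
    then show False using finite_number_of_roots[OF qP] inf finite_subset by blast
  qed
  then obtain a where a: "a \<in> carrier R" "eval q a \<noteq> \<zero>" by blast
  obtain l p' where lp: "p = l # p'" using p(2) by (cases p) auto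
  have l: "l \<in> carrier R" "l \<noteq> \<zero>"
    using lead_coeff_not_zero[of "carrier R" l p'] p(1) lp univ_poly_carrier by blast+
  define cs where "cs = map (\<lambda>c. inv l \<otimes> c) (rev p')"
  have il: "inv l \<in> carrier R" "l \<otimes> inv l = \<one>" using nonzero_inv[OF l] by auto
  have p'c: "set p' \<subseteq> carrier R" using pc lp by auto
  have cs: "set cs \<subseteq> carrier R" using il p'c by (auto simp: cs_def)
  have "map (\<lambda>c. l \<otimes> c) cs = rev p'"
    unfolding cs_def map_map using p'c il l by (intro map_idI) (auto simp: m_assoc[symmetric])
  then have rev: "rev p = map (\<lambda>c. l \<otimes> c) (cs @ [\<one>])" using l lp by simp
  have cs1: "set (cs @ [\<one>]) \<subseteq> carrier R" using cs by simp
  have nr': "monic_val R cs x \<noteq> \<zero>" if x: "x \<in> carrier R" for x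
    using nr[OF x] eval_eq_list_val[OF pc x] list_val_smult[OF cs1 x l(1)] list_val_snoc[OF cs x] l(1)
    unfolding rev by auto
  have der: "list_deriv R (cs @ [\<one>]) a \<noteq> \<zero>"
    using a(2) eval_formal_deriv[OF pc a(1)] list_deriv_smult[OF cs1 a(1) l(1)] l(1)
    unfolding rev q_def by auto
  \<comment> \<open>A monic linear polynomial X + c would have the root - c.\<close>
  have len: "2 \<le> length cs"
  proof (rule ccontr)
    assume "\<not> 2 \<le> length cs"
    moreover have "length cs = degree p" by (simp add: cs_def lp)
    ultimately obtain c where "cs = [c]" using p(2) by (cases cs; cases "tl cs") auto
    then show False using nr'[of "\<ominus> c"] cs by (auto simp: r_neg)
  qed
  define ds where "ds = translate R a cs"
  have ds: "set ds \<subseteq> carrier R" "length ds = length cs"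
    unfolding ds_def using translate_closed[OF a(1) cs] length_translate by auto
  have "ds ! 1 \<noteq> \<zero>"
    using linear_coeff_translate[OF a(1) cs] linear_coeff_nth[OF ds(1)] ds(2) len der
    by (simp add: ds_def)
  moreover have "monic_val R ds x \<noteq> \<zero>" if "x \<in> carrier R" for x
    using monic_val_translate[OF a(1) cs that] nr'[of "x \<oplus> a"] that a(1) by (simp add: ds_def)
  moreover have "ds \<in> tuples R (length cs)" using ds by (simp add: tuples_def)
  ultimately show ?thesis using len by blast
qed

lemma (in field) not_separably_closed_rootless:
  assumes "\<not> separably_closed R"
  shows "\<exists>d cs. 2 \<le> d \<and> cs \<in> tuples R d \<and> cs ! 1 \<noteq> \<zero> \<and> (\<forall>x\<in>carrier R. monic_val R cs x \<noteq> \<zero>)"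
proof (cases "finite (carrier R)")
  case True
  then show ?thesis by (rule finite_field_rootless)
next
  case False
  then show ?thesis
    using assms infinite_field_rootless field_axioms unfolding separably_closed_def by blast
qed

section \<open>Henselian valued fields\<close>

context valued_field
begin

lemma val_one: "v \<one> = 0"
  using val_mult[of \<one> \<one>] one_not_zero by simp

lemma val_inv: "\<lbrakk>x \<in> carrier K; x \<noteq> \<zero>\<rbrakk> \<Longrightarrow> v (inv x) = - v x"
  using val_mult[of x "inv x"] nonzero_inv[of x] val_one
    Groups.minus_unique[of "v x" "v (inv x)"] by simp

lemma valuation_subring_valuation_ring: "valuation_subring K (valuation_ring K v)"
proof (unfold_locales)
  fix x assume x: "x \<in> carrier K" "x \<noteq> \<zero>" "x \<notin> valuation_ring K v"
  then show "inv x \<in> valuation_ring K v"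
    using nonzero_inv[of x] val_inv[of x] by (simp add: valuation_ring_def)
next
  fix x y assume xy: "x \<in> valuation_ring K v" "y \<in> valuation_ring K v"
  show "x \<oplus> y \<in> valuation_ring K v"
  proof (cases "x = \<zero> \<or> y = \<zero> \<or> x \<oplus> y = \<zero>")
    case False
    then have "min (v x) (v y) \<le> v (x \<oplus> y)" "0 \<le> min (v x) (v y)"
      using val_add xy by (auto simp: valuation_ring_def)
    then have "0 \<le> v (x \<oplus> y)" by order
    then show ?thesis using xy by (simp add: valuation_ring_def)
  qed (use xy in \<open>auto simp: valuation_ring_def\<close>)
  show "x \<otimes> y \<in> valuation_ring K v"
    using xy val_mult[of x y] by (cases "x = \<zero> \<or> y = \<zero>") (auto simp: valuation_ring_def)
qed (auto simp: valuation_ring_def val_one)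

lemma N_valuation_ring: "valuation_subring.N K (valuation_ring K v) = valuation_ideal K v"
proof (rule Set.set_eqI)
  fix x
  show "x \<in> valuation_subring.N K (valuation_ring K v) \<longleftrightarrow> x \<in> valuation_ideal K v"
  proof (cases "x \<in> carrier K \<and> x \<noteq> \<zero>")
    case True
    then show ?thesis using nonzero_inv[of x] val_inv[of x]
      unfolding valuation_subring.N_def[OF valuation_subring_valuation_ring]
      by (simp add: valuation_ring_def valuation_ideal_def not_le)
  qed (auto simp: valuation_subring.N_def[OF valuation_subring_valuation_ring] valuation_ideal_def)
qed

end

section \<open>The residue field as a quotient ring\<close>

lemma (in valuation_subring) ring_A: "ring (R\<lparr>carrier := A\<rparr>)"
  by (rule subring_is_ring[OF subringI]) (use A_sub one_A neg_A add_A mult_A in auto)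

lemma (in valuation_subring) ideal_N: "ideal N (R\<lparr>carrier := A\<rparr>)"
proof (rule idealI[OF ring_A])
  interpret S: ring "R\<lparr>carrier := A\<rparr>" by (rule ring_A)
  show "subgroup N (add_monoid (R\<lparr>carrier := A\<rparr>))"
  proof (rule group.subgroupI[OF S.a_group])
    fix a assume a: "a \<in> N"
    have "\<ominus>\<^bsub>R\<lparr>carrier := A\<rparr>\<^esub> a = \<ominus> a"
      by (rule S.minus_equality) (use a N_A neg_A N_carrier in \<open>auto simp: l_neg\<close>)
    then show "inv\<^bsub>add_monoid (R\<lparr>carrier := A\<rparr>)\<^esub> a \<in> N" using neg_N[OF a] by (simp add: a_inv_def)
  qed (use N_A zero_N add_N in auto)
qed (use mult_N mult_N' in auto)

lemma (in valuation_subring) residue_map_quotient: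
  assumes "field ((R\<lparr>carrier := A\<rparr>) Quot N)"
  shows "residue_map R A ((R\<lparr>carrier := A\<rparr>) Quot N) (\<lambda>a. N +>\<^bsub>R\<lparr>carrier := A\<rparr>\<^esub> a)"
proof -
  interpret I: ideal N "R\<lparr>carrier := A\<rparr>" by (rule ideal_N)
  interpret F: field "(R\<lparr>carrier := A\<rparr>) Quot N" by (rule assms)
  let ?h = "\<lambda>a. N +>\<^bsub>R\<lparr>carrier := A\<rparr>\<^esub> a"
  have hom: "?h \<in> ring_hom (R\<lparr>carrier := A\<rparr>) ((R\<lparr>carrier := A\<rparr>) Quot N)" by (rule I.rcos_ring_hom)
  show ?thesis
  proof (unfold_locales)
    show "?h ` A = carrier ((R\<lparr>carrier := A\<rparr>) Quot N)"
      by (auto simp: FactRing_def A_RCOSETS_def')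
    show "?h \<one> = \<one>\<^bsub>(R\<lparr>carrier := A\<rparr>) Quot N\<^esub>" using ring_hom_one[OF hom] by simp
    fix a assume a: "a \<in> A"
    show "?h a = \<zero>\<^bsub>(R\<lparr>carrier := A\<rparr>) Quot N\<^esub> \<longleftrightarrow> a \<in> N"
      using I.rcos_const_imp_mem[of a] I.a_rcos_const[of a] a by (auto simp: FactRing_def)
    fix b assume b: "b \<in> A"
    show "?h (a \<oplus> b) = ?h a \<oplus>\<^bsub>(R\<lparr>carrier := A\<rparr>) Quot N\<^esub> ?h b"
      using ring_hom_add[OF hom, of a b] a b by simp
    show "?h (a \<otimes> b) = ?h a \<otimes>\<^bsub>(R\<lparr>carrier := A\<rparr>) Quot N\<^esub> ?h b"
      using ring_hom_mult[OF hom, of a b] a b by simp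
  qed
qed

text \<open>For the polynomial f with coefficients \<open>cs\<close> and leading coefficient 1, f(0)
  is \<open>cs ! 0\<close> and f'(0) is \<open>cs ! 1\<close>, so \<open>hensel\<close> applies at
  0.\<close>

lemma (in henselian_valued_field) henselian_subring_valuation_ring:
  "henselian_subring K (valuation_ring K v)"
proof -
  interpret V: valuation_subring K "valuation_ring K v" by (rule valuation_subring_valuation_ring)
  have VN: "V.N = valuation_ideal K v" by (rule N_valuation_ring)
  show ?thesis
  proof (unfold_locales)
    fix cs assume cs: "set cs \<subseteq> valuation_ring K v" "2 \<le> length cs" "cs ! 0 \<in> V.N" "cs ! 1 \<notin> V.N"
    have carr: "set cs \<subseteq> carrier K" using cs(1) V.A_sub by blast
    define f where "f = \<one> # rev cs"
    have fc: "set f \<subseteq> carrier K" using carr by (simp add: f_def)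
    have eval: "eval f x = monic_val K cs x" if "x \<in> carrier K" for x
      using eval_eq_list_val[OF fc that] list_val_snoc[OF carr that] by (simp add: f_def)
    have "f \<in> carrier (univ_poly K (valuation_ring K v))"
      using cs(1) V.one_A one_not_zero unfolding univ_poly_carrier[symmetric] polynomial_def f_def by simp
    moreover have "eval f \<zero> \<in> valuation_ideal K v"
      using eval[OF zero_closed] monic_val_zero[OF carr] cs(2,3) VN by (cases cs) auto
    moreover have "eval (formal_deriv K f) \<zero> \<notin> valuation_ideal K v"
      using eval_formal_deriv[OF fc zero_closed] list_deriv_snoc_zero[OF carr cs(2)] cs(4) VN
      by (simp add: f_def)
    ultimately obtain b where "b \<in> valuation_ring K v" "eval f b = \<zero>"
      using hensel[OF _ V.zero_A] by blast
    then show "\<exists>x\<in>valuation_ring K v. monic_val K cs x = \<zero>" using eval V.A_carrier by auto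
  qed
qed

theorem corollary3p9:
  fixes K :: "('a, 'b) ring_scheme"
    and v :: "'a \<Rightarrow> 'g::linordered_ab_group_add"
  assumes "henselian_valued_field K v"
    and "simple_field (residue_field K v)"
    and "\<not> separably_closed (residue_field K v)"
  shows "valuation_definable K v"
proof -
  interpret henselian_valued_field K v by (rule assms(1))
  interpret V: henselian_subring K "valuation_ring K v" by (rule henselian_subring_valuation_ring)
  define F where "F = residue_field K v"
  have F: "F = (K\<lparr>carrier := valuation_ring K v\<rparr>) Quot V.N"
    by (simp add: F_def residue_field_def N_valuation_ring)
  have simple: "field F" "simple_theory (Th F)" using assms(2) by (simp_all add: simple_field_def F_def)
  interpret F: field F by (rule simple(1))
  obtain d cs where d: "2 \<le> d" "cs \<in> tuples F d" "cs ! 1 \<noteq> \<zero>\<^bsub>F\<^esub>"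
      "\<And>x. x \<in> carrier F \<Longrightarrow> monic_val F cs x \<noteq> \<zero>\<^bsub>F\<^esub>"
    using F.not_separably_closed_rootless assms(3) unfolding F_def by metis
  define h where "h = (\<lambda>a. V.N +>\<^bsub>K\<lparr>carrier := valuation_ring K v\<rparr>\<^esub> a)"
  interpret H: residue_map K "valuation_ring K v" F h
    unfolding F h_def by (rule V.residue_map_quotient) (use simple(1) in \<open>simp add: F\<close>)
  \<comment> \<open>The simplicity of the residue field enters here, for all polynomials of degree
    \<open>d\<close> at once.\<close>
  interpret H: henselian_residue K "valuation_ring K v" F h d
    by unfold_locales (use d(1) F.simple_no_contraction[OF simple(2)] in auto)
  have "{x \<in> carrier K. sat_tuple K (valuation_ring_fm d) [x]} = valuation_ring K v"
    using H.A_eq[OF d(2-4)] sat_valuation_ring[OF field_ring_structure] by auto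
  then show ?thesis using free_vars_valuation_ring unfolding valuation_definable_def by blast
qed

end
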